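(* Let $\mathcal H$ be a compactly generated, quasi-effective and strongly equicontinuous pseudogroup of local transformations of a locally compact Polish space $Z$. Then $\mathcal H$ is a pseudogroup of local isometries with respect to some local metric inducing the topology of $Z$.
   Context: **Pseudogroups.** A pseudogroup of local transformations of a space $Z$ is a collection $\mathcal H$ of homeomorphisms between open subsets of $Z$ containing $\mathrm{id}_Z$ and closed under composition (wherever defined), inversion, restriction to open sets and combination (union) of maps. It is generated by $E\subset\mathcal H$ if all its elements are obtained from $E$ by these operations. $E$ is symmetric if $h\in E\Rightarrow h^{-1}\in E$. The orbit of $x$ is $\{h(x): h\in\mathcal H,\ x\in\operatorname{dom}h\}$. The restriction of $\mathcal H$ to an open $U\subset Z$ consists of the $h\in\mathcal H$ with domain and image in $U$. **Compact generation.** $\mathcal H$ on a locally compact $Z$ is compactly generated if there is a relatively compact open $U\subset Z$ meeting every orbit such that the restriction $\mathcal G$ of $\mathcal H$ to $U$ is generated by a finite symmetric set $E\subset\mathcal G$ such that each $g\in E$ is the restriction of some $\bar g\in\mathcal H$ defined on a neighborhood of $\overline{\operatorname{dom}g}$. **Quasi-local metrics.** A cover of a set $Z$ by quasi-locally equal metric spaces is a family $\{(Z_i,d_i)\}_{i\in I}$ of metric spaces with $Z=\bigcup_iZ_i$, each $Z_i\cap Z_j$ open in $(Z_i,d_i)$ and in $(Z_j,d_j)$, such that for all $\varepsilon>0$ there is $\delta(\varepsilon)>0$ so that: for all $i,j\in I$ and $z\in Z_i\cap Z_j$ there is an open neighborhood $U_{i,j,z}$ of $z$ in $Z_i\cap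 Z_j$ with $d_i(x,y)<\delta(\varepsilon)\Rightarrow d_j(x,y)<\varepsilon$ for all $\varepsilon>0$ and $x,y\in U_{i,j,z}$. Two such families are equivalent if their union is again such a family; an equivalence class $\mathfrak Q$ is a quasi-local metric. It induces a topology on $Z$ with base the open balls of all $(Z_i,d_i)$. **Strong equicontinuity.** A pseudogroup $\mathcal H$ on a space $Z$ is strongly equicontinuous if there are a quasi-local metric $\mathfrak Q$ inducing the topology of $Z$, some $\{(Z_i,d_i)\}_{i\in I}\in\mathfrak Q$ and a symmetric set $S$ of generators of $\mathcal H$, closed under compositions, such that for every $\varepsilon>0$ there is $\delta(\varepsilon)>0$ with $d_i(x,y)<\delta(\varepsilon)\Rightarrow d_j(h(x),h(y))<\varepsilon$ for all $h\in S$, $i,j\in I$ and $x,y\in Z_i\cap h^{-1}(Z_j\cap\operatorname{im}h)$. **Quasi-effectiveness.** $\mathcal H$ is quasi-effective if it is generated by some symmetric set $S$, closed under compositions, such that any transformation in $S$ is the identity on its domain if it is the identity on some non-empty open subset of its domain. **Local metrics.** Two metrics on the same set are locally equal when they induce the same topology and each point has a neighborhood where both metrics are equal. A cover of a set $Z$ by locally equal metric spaces is a family $\{(Z_i,d_i)\}_{i\in I}$ of metric spaces with $Z=\bigcup_iZ_i$, each $Z_i\cap Z_j$ open in $(Z_i,d_i)$ and $(Z_j,d_j)$, and $d_i,d_j$ locally equal on $Z_i\cap Z_j$ whenever non-empty. Two such families are equivalent when their union is again such a family; an equivalence class $\mathfrak D$ is a local metric on $Z$. It induces the topology on $Z$ with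 base the open balls of all $(Z_i,d_i)$. **Local isometries.** A homeomorphism $h$ between open subsets of $(Z,\mathfrak D)$ is a local isometry if there is some $\{(Z_i,d_i)\}_{i\in I}\in\mathfrak D$ such that for all $i,j\in I$ and $z\in Z_i\cap h^{-1}(Z_j\cap\operatorname{im}h)$ there is a neighborhood $U_{h,i,j,z}$ of $z$ in $Z_i\cap h^{-1}(Z_j\cap\operatorname{im}h)$ with $d_i(x,y)=d_j(h(x),h(y))$ for all $x,y\in U_{h,i,j,z}$. A pseudogroup of local isometries is a pseudogroup all of whose elements are local isometries. *)

theory Defs
  imports "HOL-Analysis.Analysis"
begin

section \<open>Pseudogroups of local transformations\<close>

text \<open>
  A local transformation of a space \<open>Z\<close> is a partial map \<open>h\<close> of type \<open>'a \<rightharpoonup> 'a\<close>, so that \<open>dom h\<close>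
  and \<open>ran h\<close> are part of the data and equality of partial maps is equality of transformations.
\<close>

definition local_transformation :: "'a topology \<Rightarrow> ('a \<rightharpoonup> 'a) \<Rightarrow> bool" where
  "local_transformation Z h \<longleftrightarrow>
     openin Z (dom h) \<and> openin Z (ran h) \<and>
     homeomorphic_map (subtopology Z (dom h)) (subtopology Z (ran h)) (the \<circ> h)"

definition map_inverse :: "('a \<rightharpoonup> 'a) \<Rightarrow> ('a \<rightharpoonup> 'a)" where
  "map_inverse h = (Some \<circ> inv_into (dom h) (the \<circ> h)) |` ran h"

lemma map_inverse_eq_Some_iff:
  assumes "inj_on (the \<circ> h) (dom h)"
  shows "map_inverse h y = Some x \<longleftrightarrow> h x = Some y"
proof
  assume "map_inverse h y = Some x"
  then have y: "y \<in> ran h" and x: "x = inv_into (dom h) (the \<circ> h) y"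
    by (auto simp: map_inverse_def restrict_map_def split: if_splits)
  from y have img: "y \<in> (the \<circ> h) ` dom h"
    by (force simp: ran_def image_iff)
  have "x \<in> dom h" "(the \<circ> h) x = y"
    unfolding x using img by (rule inv_into_into, rule f_inv_into_f)
  then show "h x = Some y" by auto
next
  assume h: "h x = Some y"
  then have "inv_into (dom h) (the \<circ> h) ((the \<circ> h) x) = x"
    using assms by (intro inv_into_f_f) auto
  with h show "map_inverse h y = Some x"
    by (auto simp: map_inverse_def restrict_map_def intro: ranI)
qed

definition map_preimage :: "('a \<rightharpoonup> 'a) \<Rightarrow> 'a set \<Rightarrow> 'a set" where
  "map_preimage h A = {x \<in> dom h. the (h x) \<in> A}"

definition combination_of :: "('a \<rightharpoonup> 'a) \<Rightarrow> ('a \<rightharpoonup> 'a) set \<Rightarrow> bool" where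
  "combination_of g A \<longleftrightarrow> dom g = (\<Union>h\<in>A. dom h) \<and> (\<forall>h\<in>A. h \<subseteq>\<^sub>m g)"

definition symmetric_maps :: "('a \<rightharpoonup> 'a) set \<Rightarrow> bool" where
  "symmetric_maps E \<longleftrightarrow> (\<forall>h\<in>E. map_inverse h \<in> E)"

definition composition_closed :: "('a \<rightharpoonup> 'a) set \<Rightarrow> bool" where
  "composition_closed E \<longleftrightarrow> (\<forall>g\<in>E. \<forall>h\<in>E. g \<circ>\<^sub>m h \<in> E)"

text \<open>
  The composition \<open>g \<circ>\<^sub>m h\<close> has domain \<open>{x \<in> dom h. the (h x) \<in> dom g}\<close>, possibly empty. A combination
  is required to belong to the pseudogroup only if it is itself a homeomorphism between open sets.
\<close>

definition pseudogroup :: "'a topology \<Rightarrow> ('a \<rightharpoonup> 'a) set \<Rightarrow> bool" where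
  "pseudogroup Z H \<longleftrightarrow>
     (\<forall>h\<in>H. local_transformation Z h) \<and>
     Some |` topspace Z \<in> H \<and>
     composition_closed H \<and>
     symmetric_maps H \<and>
     (\<forall>h\<in>H. \<forall>W. openin Z W \<longrightarrow> h |` W \<in> H) \<and>
     (\<forall>A g. A \<subseteq> H \<and> local_transformation Z g \<and> combination_of g A \<longrightarrow> g \<in> H)"

text \<open>
  The identity of \<open>Z\<close> counts as a nullary operation: the domains of the generators need not cover \<open>Z\<close>.
\<close>

inductive_set generated_pseudogroup :: "'a topology \<Rightarrow> ('a \<rightharpoonup> 'a) set \<Rightarrow> ('a \<rightharpoonup> 'a) set"
  for Z :: "'a topology" and E :: "('a \<rightharpoonup> 'a) set" where
  generator: "h \<in> E \<Longrightarrow> h \<in> generated_pseudogroup Z E"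
| identity: "Some |` topspace Z \<in> generated_pseudogroup Z E"
| composition:
    "g \<in> generated_pseudogroup Z E \<Longrightarrow> h \<in> generated_pseudogroup Z E \<Longrightarrow>
     g \<circ>\<^sub>m h \<in> generated_pseudogroup Z E"
| inversion: "h \<in> generated_pseudogroup Z E \<Longrightarrow> map_inverse h \<in> generated_pseudogroup Z E"
| restriction:
    "h \<in> generated_pseudogroup Z E \<Longrightarrow> openin Z W \<Longrightarrow> h |` W \<in> generated_pseudogroup Z E"
| combination:
    "(\<And>h. h \<in> A \<Longrightarrow> h \<in> generated_pseudogroup Z E) \<Longrightarrow> local_transformation Z g \<Longrightarrow>
     combination_of g A \<Longrightarrow> g \<in> generated_pseudogroup Z E"

definition generates :: "'a topology \<Rightarrow> ('a \<rightharpoonup> 'a) set \<Rightarrow> ('a \<rightharpoonup> 'a) set \<Rightarrow> bool" where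
  "generates Z E H \<longleftrightarrow> E \<subseteq> H \<and> H \<subseteq> generated_pseudogroup Z E"

definition orbit_of :: "('a \<rightharpoonup> 'a) set \<Rightarrow> 'a \<Rightarrow> 'a set" where
  "orbit_of H x = {y. \<exists>h\<in>H. h x = Some y}"

definition pseudogroup_restriction :: "('a \<rightharpoonup> 'a) set \<Rightarrow> 'a set \<Rightarrow> ('a \<rightharpoonup> 'a) set" where
  "pseudogroup_restriction H U = {h \<in> H. dom h \<subseteq> U \<and> ran h \<subseteq> U}"

text \<open>
  The elements of \<open>H\<close> have open domains, so being defined on a neighbourhood of a set amounts to
  having a domain that contains it. Closures are taken in \<open>Z\<close>, not in \<open>U\<close>.
\<close>

definition compactly_generated :: "'a topology \<Rightarrow> ('a \<rightharpoonup> 'a) set \<Rightarrow> bool" where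
  "compactly_generated Z H \<longleftrightarrow>
     (\<exists>U. openin Z U \<and> compactin Z (Z closure_of U) \<and>
          (\<forall>x\<in>topspace Z. orbit_of H x \<inter> U \<noteq> {}) \<and>
          (\<exists>E. finite E \<and> symmetric_maps E \<and>
               generates (subtopology Z U) E (pseudogroup_restriction H U) \<and>
               (\<forall>g\<in>E. \<exists>g'\<in>H. Z closure_of dom g \<subseteq> dom g' \<and> g = g' |` dom g)))"

definition quasi_effective :: "'a topology \<Rightarrow> ('a \<rightharpoonup> 'a) set \<Rightarrow> bool" where
  "quasi_effective Z H \<longleftrightarrow>
     (\<exists>S. generates Z S H \<and> symmetric_maps S \<and> composition_closed S \<and>
          (\<forall>h\<in>S. (\<exists>W. openin Z W \<and> W \<noteq> {} \<and> W \<subseteq> dom h \<and> (\<forall>x\<in>W. h x = Some x)) \<longrightarrow>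
                 (\<forall>x\<in>dom h. h x = Some x)))"

section \<open>Quasi-local and local metrics\<close>

text \<open>
  Families of metric spaces are sets of metrics on subsets of the ambient type, each metric carrying
  its own underlying set \<open>mspace m\<close>. Every condition below quantifies over pairs of members, possibly
  equal, so repetitions in an indexed family are immaterial.
\<close>

definition quasi_locally_equal_cover :: "'a set \<Rightarrow> 'a metric set \<Rightarrow> bool" where
  "quasi_locally_equal_cover S F \<longleftrightarrow>
     S = (\<Union>m\<in>F. mspace m) \<and>
     (\<forall>m\<in>F. \<forall>m'\<in>F. openin (mtopology_of m) (mspace m \<inter> mspace m') \<and>
                    openin (mtopology_of m') (mspace m \<inter> mspace m')) \<and>
     (\<exists>\<delta> :: real \<Rightarrow> real.
        (\<forall>\<epsilon>>0. \<delta> \<epsilon> > 0) \<and>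
        (\<forall>m\<in>F. \<forall>m'\<in>F. \<forall>z \<in> mspace m \<inter> mspace m'.
           \<exists>U. openin (mtopology_of m) U \<and> openin (mtopology_of m') U \<and>
               z \<in> U \<and> U \<subseteq> mspace m \<inter> mspace m' \<and>
               (\<forall>\<epsilon>>0. \<forall>x\<in>U. \<forall>y\<in>U. mdist m x y < \<delta> \<epsilon> \<longrightarrow> mdist m' x y < \<epsilon>)))"

definition metrics_locally_equal :: "'a metric \<Rightarrow> 'a metric \<Rightarrow> bool" where
  "metrics_locally_equal m m' \<longleftrightarrow>
     mspace m = mspace m' \<and> mtopology_of m = mtopology_of m' \<and>
     (\<forall>z\<in>mspace m. \<exists>U. openin (mtopology_of m) U \<and> z \<in> U \<and>
                        (\<forall>x\<in>U. \<forall>y\<in>U. mdist m x y = mdist m' x y))"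

definition locally_equal_cover :: "'a set \<Rightarrow> 'a metric set \<Rightarrow> bool" where
  "locally_equal_cover S F \<longleftrightarrow>
     S = (\<Union>m\<in>F. mspace m) \<and>
     (\<forall>m\<in>F. \<forall>m'\<in>F.
        openin (mtopology_of m) (mspace m \<inter> mspace m') \<and>
        openin (mtopology_of m') (mspace m \<inter> mspace m') \<and>
        (mspace m \<inter> mspace m' \<noteq> {} \<longrightarrow>
           metrics_locally_equal (submetric m (mspace m \<inter> mspace m'))
                                 (submetric m' (mspace m \<inter> mspace m'))))"

definition union_equivalence :: "('a metric set \<Rightarrow> bool) \<Rightarrow> ('a metric set \<times> 'a metric set) set" where
  "union_equivalence P = {(F, G). P F \<and> P G \<and> P (F \<union> G)}"

definition quasi_local_metric :: "'a set \<Rightarrow> 'a metric set set \<Rightarrow> bool" where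
  "quasi_local_metric S Q \<longleftrightarrow>
     Q \<in> Collect (quasi_locally_equal_cover S) // union_equivalence (quasi_locally_equal_cover S)"

definition local_metric :: "'a set \<Rightarrow> 'a metric set set \<Rightarrow> bool" where
  "local_metric S D \<longleftrightarrow>
     D \<in> Collect (locally_equal_cover S) // union_equivalence (locally_equal_cover S)"

definition open_balls :: "'a metric set \<Rightarrow> 'a set set" where
  "open_balls F = {Metric_space.mball (mspace m) (mdist m) x r | m x r. m \<in> F \<and> x \<in> mspace m \<and> r > 0}"

text \<open>
  Equivalent families induce the same topology, so it makes no difference whether all or some
  representatives are considered.
\<close>

definition induces_topology :: "'a metric set set \<Rightarrow> 'a topology \<Rightarrow> bool" where
  "induces_topology Q Z \<longleftrightarrow> (\<forall>F\<in>Q. openin Z = arbitrary union_of (\<lambda>B. B \<in> open_balls F))"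

definition strongly_equicontinuous :: "'a topology \<Rightarrow> ('a \<rightharpoonup> 'a) set \<Rightarrow> bool" where
  "strongly_equicontinuous Z H \<longleftrightarrow>
     (\<exists>Q. quasi_local_metric (topspace Z) Q \<and> induces_topology Q Z \<and>
        (\<exists>F\<in>Q. \<exists>S. generates Z S H \<and> symmetric_maps S \<and> composition_closed S \<and>
           (\<forall>\<epsilon>::real. \<epsilon> > 0 \<longrightarrow> (\<exists>\<delta>::real. \<delta> > 0 \<and>
              (\<forall>h\<in>S. \<forall>m\<in>F. \<forall>m'\<in>F.
                 \<forall>x \<in> mspace m \<inter> map_preimage h (mspace m' \<inter> ran h).
                 \<forall>y \<in> mspace m \<inter> map_preimage h (mspace m' \<inter> ran h).
                   mdist m x y < \<delta> \<longrightarrow> mdist m' (the (h x)) (the (h y)) < \<epsilon>)))))"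

text \<open>Here \<open>Z\<close> is meant to be the topology induced by \<open>D\<close>; the family may depend on \<open>h\<close>.\<close>

definition local_isometry :: "'a topology \<Rightarrow> 'a metric set set \<Rightarrow> ('a \<rightharpoonup> 'a) \<Rightarrow> bool" where
  "local_isometry Z D h \<longleftrightarrow>
     local_transformation Z h \<and>
     (\<exists>F\<in>D. \<forall>m\<in>F. \<forall>m'\<in>F.
        \<forall>z \<in> mspace m \<inter> map_preimage h (mspace m' \<inter> ran h).
          \<exists>U. openin (subtopology Z (mspace m \<inter> map_preimage h (mspace m' \<inter> ran h))) U \<and> z \<in> U \<and>
              (\<forall>x\<in>U. \<forall>y\<in>U. mdist m x y = mdist m' (the (h x)) (the (h y))))"

definition pseudogroup_of_local_isometries ::
    "'a topology \<Rightarrow> 'a metric set set \<Rightarrow> ('a \<rightharpoonup> 'a) set \<Rightarrow> bool" where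
  "pseudogroup_of_local_isometries Z D H \<longleftrightarrow> pseudogroup Z H \<and> (\<forall>h\<in>H. local_isometry Z D h)"

end

theory Submission
  imports Defs
begin

text \<open>
  Let \<open>U\<close> be the relatively compact open set of compact generation and \<open>d\<close> any bounded metric on \<open>Z\<close>.
  Compact generation and strong equicontinuity together give a uniform extension property: every
  germ from a point of \<open>U\<close> to a point of \<open>U\<close> extends to a ball of fixed radius with small image.
  Quasi-effectiveness makes such extensions unique on slightly smaller sets. On a small open set
  \<open>W\<close>, the supremum of \<open>rho (s x) (s y)\<close> over all transformations \<open>s\<close> with domain \<open>W\<close> is therefore a
  metric that is locally independent of \<open>W\<close> and locally invariant, provided that the transformations
  leaving \<open>U\<close> do not count; this is achieved by letting \<open>rho\<close> be \<open>d\<close> with the complement of \<open>U\<close>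
  collapsed to a point.
\<close>

section \<open>Local transformations and their germs\<close>

definition map_image :: "('a \<rightharpoonup> 'a) \<Rightarrow> 'a set \<Rightarrow> 'a set" where
  "map_image h W = {y. \<exists>x\<in>W. h x = Some y}"

lemma in_map_image_iff [simp]: "y \<in> map_image h W \<longleftrightarrow> (\<exists>x\<in>W. h x = Some y)"
  by (simp add: map_image_def)

lemma in_map_preimage_iff [simp]: "x \<in> map_preimage h W \<longleftrightarrow> (\<exists>y\<in>W. h x = Some y)"
  by (auto simp: map_preimage_def)

lemma local_transformation_iff:
  "local_transformation Z h \<longleftrightarrow>
     dom h \<subseteq> topspace Z \<and> ran h \<subseteq> topspace Z \<and>
     (\<forall>x x' y. h x = Some y \<longrightarrow> h x' = Some y \<longrightarrow> x = x') \<and>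
     (\<forall>W. openin Z W \<longrightarrow> openin Z (map_preimage h W)) \<and>
     (\<forall>W. openin Z W \<longrightarrow> openin Z (map_image h W))"
  (is "?L \<longleftrightarrow> ?R")
proof
  assume ?L
  then have op: "openin Z (dom h)" "openin Z (ran h)"
    and hom: "homeomorphic_map (subtopology Z (dom h)) (subtopology Z (ran h)) (the \<circ> h)"
    by (auto simp: local_transformation_def)
  have sub: "dom h \<subseteq> topspace Z" "ran h \<subseteq> topspace Z"
    using op openin_subset by auto
  have ts: "topspace (subtopology Z (dom h)) = dom h"
    using sub by auto
  have "inj_on (the \<circ> h) (dom h)"
    using homeomorphic_imp_injective_map[OF hom] ts by simp
  then have inj: "\<forall>x x' y. h x = Some y \<longrightarrow> h x' = Some y \<longrightarrow> x = x'"
    by (metis comp_apply domI inj_onD option.sel)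
  have pre: "openin Z (map_preimage h W)" if W: "openin Z W" for W
  proof -
    have "openin (subtopology Z (ran h)) (W \<inter> ran h)"
      using W by (simp add: openin_subtopology_Int)
    then have "openin (subtopology Z (dom h)) {x \<in> dom h. (the \<circ> h) x \<in> W \<inter> ran h}"
      using homeomorphic_imp_continuous_map[OF hom] unfolding continuous_map_def ts by blast
    moreover have "{x \<in> dom h. (the \<circ> h) x \<in> W \<inter> ran h} = map_preimage h W"
      by (auto simp: map_preimage_def intro: ranI)
    ultimately show ?thesis
      using op by (simp add: openin_open_subtopology)
  qed
  have im: "openin Z (map_image h W)" if W: "openin Z W" for W
  proof -
    have "openin (subtopology Z (dom h)) (W \<inter> dom h)"
      using W by (simp add: openin_subtopology_Int)
    then have "openin (subtopology Z (ran h)) ((the \<circ> h) ` (W \<inter> dom h))"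
      using homeomorphic_imp_open_map[OF hom] unfolding open_map_def by auto
    moreover have "(the \<circ> h) ` (W \<inter> dom h) = map_image h W"
      by (auto simp: image_iff) (metis IntI domI option.sel)
    ultimately show ?thesis
      using op by (simp add: openin_open_subtopology)
  qed
  show ?R using sub inj pre im by blast
next
  assume R: ?R
  have "map_preimage h (topspace Z) = dom h" "map_image h (topspace Z) = ran h"
    using R by (auto simp: ran_def subset_iff) blast+
  then have op: "openin Z (dom h)" "openin Z (ran h)"
    using R by (metis openin_topspace)+
  have ts: "topspace (subtopology Z (dom h)) = dom h" "topspace (subtopology Z (ran h)) = ran h"
    using R by auto
  have "continuous_map (subtopology Z (dom h)) (subtopology Z (ran h)) (the \<circ> h)"
    unfolding continuous_map_def ts
  proof (intro conjI allI impI)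
    show "the \<circ> h \<in> dom h \<rightarrow> ran h" by (auto intro: ranI)
    fix V assume V: "openin (subtopology Z (ran h)) V"
    then have "openin Z V" using op by (simp add: openin_open_subtopology)
    then have "openin Z (map_preimage h V)" using R by blast
    moreover have "map_preimage h V = {x \<in> dom h. (the \<circ> h) x \<in> V}"
      by (auto simp: map_preimage_def)
    ultimately show "openin (subtopology Z (dom h)) {x \<in> dom h. (the \<circ> h) x \<in> V}"
      using op by (simp add: openin_open_subtopology)
  qed
  moreover have "open_map (subtopology Z (dom h)) (subtopology Z (ran h)) (the \<circ> h)"
    unfolding open_map_def
  proof (intro allI impI)
    fix V assume V: "openin (subtopology Z (dom h)) V"
    then have V': "openin Z V" "V \<subseteq> dom h" using op by (auto simp: openin_open_subtopology)
    then have "openin Z (map_image h V)" using R by blast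
    moreover have "h u = Some (the (h u))" if "u \<in> V" for u
      using V' that by force
    then have "map_image h V = (the \<circ> h) ` V"
      by (auto simp: image_iff) (metis option.sel)
    moreover have "map_image h V \<subseteq> ran h" by (auto intro: ranI)
    ultimately show "openin (subtopology Z (ran h)) ((the \<circ> h) ` V)"
      using op by (simp add: openin_open_subtopology)
  qed
  moreover have "(the \<circ> h) ` dom h = ran h"
    by (auto simp: ran_def image_iff) (metis domI option.sel)
  moreover have "inj_on (the \<circ> h) (dom h)"
    using R by (auto simp: inj_on_def)
  ultimately have "homeomorphic_map (subtopology Z (dom h)) (subtopology Z (ran h)) (the \<circ> h)"
    by (intro bijective_open_imp_homeomorphic_map) (simp_all only: ts)
  with op show ?L by (simp add: local_transformation_def)
qed

lemma local_transformation_inj: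
  "local_transformation Z h \<Longrightarrow> h x = Some y \<Longrightarrow> h x' = Some y \<Longrightarrow> x = x'"
  by (simp add: local_transformation_iff)

lemma local_transformation_preimage:
  "local_transformation Z h \<Longrightarrow> openin Z W \<Longrightarrow> openin Z (map_preimage h W)"
  by (simp add: local_transformation_iff)

lemma local_transformation_image:
  "local_transformation Z h \<Longrightarrow> openin Z W \<Longrightarrow> openin Z (map_image h W)"
  by (simp add: local_transformation_iff)

lemma local_transformation_in_topspace:
  "local_transformation Z h \<Longrightarrow> h x = Some y \<Longrightarrow> x \<in> topspace Z \<and> y \<in> topspace Z"
  by (auto simp: local_transformation_iff ran_def)

lemma local_transformation_open_dom: "local_transformation Z h \<Longrightarrow> openin Z (dom h)"
  by (simp add: local_transformation_def)

lemma map_inverse_Some_iff: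
  assumes "local_transformation Z h"
  shows "map_inverse h y = Some x \<longleftrightarrow> h x = Some y"
proof (rule map_inverse_eq_Some_iff, rule inj_onI)
  fix x x' assume "x \<in> dom h" "x' \<in> dom h" "(the \<circ> h) x = (the \<circ> h) x'"
  then show "x = x'"
    using local_transformation_inj[OF assms] by auto
qed

lemma map_eqI: "(\<And>x y. f x = Some y \<longleftrightarrow> g x = Some y) \<Longrightarrow> f = g"
  by (rule ext) (metis not_None_eq)

lemma map_comp_Some: "(g \<circ>\<^sub>m h) x = Some z \<longleftrightarrow> (\<exists>y. h x = Some y \<and> g y = Some z)"
  by (auto simp: map_comp_Some_iff)

lemma restrict_map_Some: "(h |` W) x = Some y \<longleftrightarrow> x \<in> W \<and> h x = Some y"
  by (auto simp: restrict_map_def)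

lemma local_transformation_id: "local_transformation Z (Some |` topspace Z)"
proof -
  have "map_preimage (Some |` topspace Z) W = W" "map_image (Some |` topspace Z) W = W"
    if "openin Z W" for W
    using openin_subset[OF that] by (auto simp: restrict_map_Some)
  then show ?thesis
    by (auto simp: local_transformation_iff restrict_map_Some ran_def)
qed

lemma local_transformation_comp:
  assumes "local_transformation Z g" "local_transformation Z h"
  shows "local_transformation Z (g \<circ>\<^sub>m h)"
proof -
  have "map_preimage (g \<circ>\<^sub>m h) W = map_preimage h (map_preimage g W)" for W
    by (rule set_eqI) (simp add: map_comp_Some Bex_def, blast)
  moreover have "map_image (g \<circ>\<^sub>m h) W = map_image g (map_image h W)" for W
    by (rule set_eqI) (simp add: map_comp_Some Bex_def, blast)
  moreover have "dom (g \<circ>\<^sub>m h) \<subseteq> dom h" "ran (g \<circ>\<^sub>m h) \<subseteq> ran g"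
    by (auto simp: map_comp_Some ran_def)
  ultimately show ?thesis
    using assms unfolding local_transformation_iff by (auto simp: map_comp_Some) blast
qed

lemma local_transformation_inverse:
  assumes "local_transformation Z h"
  shows "local_transformation Z (map_inverse h)"
proof -
  note inv = map_inverse_Some_iff[OF assms]
  have "map_preimage (map_inverse h) W = map_image h W"
    "map_image (map_inverse h) W = map_preimage h W" for W
    by (auto simp: inv)
  moreover have "dom (map_inverse h) = ran h" "ran (map_inverse h) = dom h"
    by (auto simp: dom_def ran_def inv)
  ultimately show ?thesis
    using assms unfolding local_transformation_iff by (simp add: inv)
qed

lemma local_transformation_restrict:
  assumes "local_transformation Z h" "openin Z W"
  shows "local_transformation Z (h |` W)"
proof -
  have "map_preimage (h |` W) V = W \<inter> map_preimage h V" "map_image (h |` W) V = map_image h (W \<inter> V)"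
    for V by (auto simp: restrict_map_Some)
  moreover have "dom (h |` W) \<subseteq> dom h" "ran (h |` W) \<subseteq> ran h"
    by (auto simp: restrict_map_Some ran_def)
  ultimately show ?thesis
    using assms unfolding local_transformation_iff by (auto simp: restrict_map_Some)
qed

lemma local_transformation_subtopology:
  assumes "openin Z U" "local_transformation Z h" "dom h \<subseteq> U" "ran h \<subseteq> U"
  shows "local_transformation (subtopology Z U) h"
proof -
  have "map_image h W \<subseteq> ran h" "map_preimage h W \<subseteq> dom h" for W
    by (auto intro: ranI)
  then have "map_image h W \<subseteq> U" "map_preimage h W \<subseteq> U" for W
    using assms by blast+
  then show ?thesis
    using assms unfolding local_transformation_iff
    by (auto simp: openin_open_subtopology)
qed

definition germ_eq :: "'a topology \<Rightarrow> ('a \<rightharpoonup> 'a) \<Rightarrow> ('a \<rightharpoonup> 'a) \<Rightarrow> 'a \<Rightarrow> bool" where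
  "germ_eq Z f g x \<longleftrightarrow> (\<exists>W. openin Z W \<and> x \<in> W \<and> (\<forall>v\<in>W. f v = g v))"

lemma germ_eq_refl: "x \<in> topspace Z \<Longrightarrow> germ_eq Z f f x"
  by (auto simp: germ_eq_def)

lemma germ_eq_sym: "germ_eq Z f g x \<Longrightarrow> germ_eq Z g f x"
  unfolding germ_eq_def by metis

lemma germ_eq_trans: "germ_eq Z f g x \<Longrightarrow> germ_eq Z g h x \<Longrightarrow> germ_eq Z f h x"
  unfolding germ_eq_def by (metis IntD1 IntD2 IntI openin_Int)

lemma germ_eq_at: "germ_eq Z f g x \<Longrightarrow> f x = g x"
  by (auto simp: germ_eq_def)

lemma germ_eq_restrict: "openin Z W \<Longrightarrow> x \<in> W \<Longrightarrow> germ_eq Z (h |` W) h x"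
  by (auto simp: germ_eq_def)

lemma germ_eq_comp:
  assumes "germ_eq Z g g' y" "germ_eq Z h h' x" "local_transformation Z h" "h x = Some y"
  shows "germ_eq Z (g \<circ>\<^sub>m h) (g' \<circ>\<^sub>m h') x"
proof -
  obtain V W where V: "openin Z V" "y \<in> V" "\<forall>v\<in>V. g v = g' v"
    and W: "openin Z W" "x \<in> W" "\<forall>v\<in>W. h v = h' v"
    using assms(1,2) by (auto simp: germ_eq_def)
  have "openin Z (W \<inter> map_preimage h V)"
    using local_transformation_preimage[OF assms(3) V(1)] W(1) by blast
  then show ?thesis
    unfolding germ_eq_def using V W assms(4)
    by (intro exI[of _ "W \<inter> map_preimage h V"]) (auto simp: map_comp_def split: option.splits)
qed

lemma germ_eq_inverse:
  assumes "germ_eq Z h h' x" "local_transformation Z h" "local_transformation Z h'" "h x = Some y"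
  shows "germ_eq Z (map_inverse h) (map_inverse h') y"
proof -
  obtain W where W: "openin Z W" "x \<in> W" "\<forall>v\<in>W. h v = h' v"
    using assms(1) by (auto simp: germ_eq_def)
  have "map_inverse h v = map_inverse h' v" if "v \<in> map_image h W" for v
  proof -
    from that obtain u where "u \<in> W" "h u = Some v" by auto
    then have "map_inverse h v = Some u" "map_inverse h' v = Some u"
      using W by (auto simp: map_inverse_Some_iff[OF assms(2)] map_inverse_Some_iff[OF assms(3)])
    then show ?thesis by simp
  qed
  then show ?thesis
    unfolding germ_eq_def using W assms(4) local_transformation_image[OF assms(2) W(1)]
    by (metis in_map_image_iff)
qed

inductive_set words :: "'a topology \<Rightarrow> ('a \<rightharpoonup> 'a) set \<Rightarrow> ('a \<rightharpoonup> 'a) set"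
  for Z :: "'a topology" and E :: "('a \<rightharpoonup> 'a) set" where
  empty: "Some |` topspace Z \<in> words Z E"
| cons: "e \<in> E \<Longrightarrow> w \<in> words Z E \<Longrightarrow> e \<circ>\<^sub>m w \<in> words Z E"

lemma comp_id:
  "local_transformation Z h \<Longrightarrow> h \<circ>\<^sub>m (Some |` topspace Z) = h"
  "local_transformation Z h \<Longrightarrow> (Some |` topspace Z) \<circ>\<^sub>m h = h"
  by (auto intro!: map_eqI simp: map_comp_Some restrict_map_Some dest: local_transformation_in_topspace)

lemma comp_assoc: "(f \<circ>\<^sub>m g) \<circ>\<^sub>m h = f \<circ>\<^sub>m (g \<circ>\<^sub>m h)"
  by (rule map_eqI) (auto simp: map_comp_Some)

lemma map_inverse_id: "map_inverse (Some |` topspace Z) = Some |` topspace Z"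
  by (rule map_eqI) (auto simp: map_inverse_Some_iff[OF local_transformation_id] restrict_map_Some)

lemma map_inverse_comp:
  assumes "local_transformation Z g" "local_transformation Z h"
  shows "map_inverse (g \<circ>\<^sub>m h) = map_inverse h \<circ>\<^sub>m map_inverse g"
  using assms
  by (intro map_eqI) (auto simp: map_inverse_Some_iff map_inverse_Some_iff[OF local_transformation_comp] map_comp_Some)

lemma words_local_transformation:
  assumes "\<And>e. e \<in> E \<Longrightarrow> local_transformation Z e" "w \<in> words Z E"
  shows "local_transformation Z w"
  using assms(2) by induction (auto intro: local_transformation_id local_transformation_comp assms(1))

lemma words_comp:
  assumes "\<And>e. e \<in> E \<Longrightarrow> local_transformation Z e" "w \<in> words Z E" "w' \<in> words Z E"
  shows "w \<circ>\<^sub>m w' \<in> words Z E"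
  using assms(2)
proof induction
  case empty
  then show ?case using comp_id(2)[OF words_local_transformation[OF assms(1,3)]] assms(3) by simp
next
  case (cons e w)
  then show ?case by (simp add: comp_assoc words.cons)
qed

lemma words_inverse:
  assumes "\<And>e. e \<in> E \<Longrightarrow> local_transformation Z e" "symmetric_maps E" "w \<in> words Z E"
  shows "map_inverse w \<in> words Z E"
  using assms(3)
proof induction
  case empty
  then show ?case by (simp add: map_inverse_id words.empty)
next
  case (cons e w)
  have "map_inverse e \<in> E"
    using cons assms(2) by (auto simp: symmetric_maps_def)
  then have "map_inverse e \<in> words Z E"
    using words.cons[OF _ words.empty, of _ E Z] comp_id(1)[OF assms(1)] by metis
  then show ?case
    using cons assms(1) words_local_transformation[OF assms(1)] words_comp[OF assms(1)]
    by (metis map_inverse_comp)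
qed

lemma generated_germ_word:
  assumes lt: "\<And>e. e \<in> E \<Longrightarrow> local_transformation Z e" and sym: "symmetric_maps E"
    and "h \<in> generated_pseudogroup Z E"
  shows "local_transformation Z h \<and> (\<forall>x\<in>dom h. \<exists>w\<in>words Z E. germ_eq Z h w x)"
  using assms(3)
proof induction
  case (generator h)
  then have "local_transformation Z h" "h \<in> words Z E"
    using lt words.cons[OF generator words.empty, of Z] comp_id(1)[OF lt] by metis+
  then show ?case
    by (metis germ_eq_refl local_transformation_in_topspace domD)
next
  case identity
  then show ?case
    using local_transformation_id
    by (metis germ_eq_refl local_transformation_in_topspace domD words.empty)
next
  case (composition g h)
  show ?case
  proof (intro conjI ballI)
    show "local_transformation Z (g \<circ>\<^sub>m h)"
      using composition local_transformation_comp by blast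
    fix x assume "x \<in> dom (g \<circ>\<^sub>m h)"
    then obtain y z where "h x = Some y" "g y = Some z" by (auto simp: map_comp_Some)
    then obtain w w' where "w \<in> words Z E" "germ_eq Z h w x" "w' \<in> words Z E" "germ_eq Z g w' y"
      using composition.IH by blast
    then show "\<exists>w\<in>words Z E. germ_eq Z (g \<circ>\<^sub>m h) w x"
      using germ_eq_comp words_comp[OF lt] composition.IH \<open>h x = Some y\<close> by metis
  qed
next
  case (inversion h)
  show ?case
  proof (intro conjI ballI)
    show "local_transformation Z (map_inverse h)"
      using inversion local_transformation_inverse by blast
    fix y assume "y \<in> dom (map_inverse h)"
    then obtain x where x: "h x = Some y"
      using inversion.IH by (auto simp: map_inverse_Some_iff)
    then obtain w where "w \<in> words Z E" "germ_eq Z h w x"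
      using inversion.IH by blast
    then show "\<exists>w\<in>words Z E. germ_eq Z (map_inverse h) w y"
      using germ_eq_inverse[of Z h w x y] words_inverse[OF lt sym] words_local_transformation[OF lt]
        inversion.IH x by metis
  qed
next
  case (restriction h W)
  show ?case
  proof (intro conjI ballI)
    show "local_transformation Z (h |` W)"
      using restriction local_transformation_restrict by blast
    fix x assume "x \<in> dom (h |` W)"
    then have "x \<in> dom h" "x \<in> W" by auto
    then show "\<exists>w\<in>words Z E. germ_eq Z (h |` W) w x"
      using restriction germ_eq_restrict germ_eq_trans by metis
  qed
next
  case (combination A g)
  show ?case
  proof (intro conjI ballI)
    show "local_transformation Z g" by fact
    fix x assume "x \<in> dom g"
    then obtain h where h: "h \<in> A" "x \<in> dom h" "h \<subseteq>\<^sub>m g"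
      using combination by (auto simp: combination_of_def)
    then have "germ_eq Z g h x"
      unfolding germ_eq_def using combination.IH local_transformation_open_dom[of Z h]
      by (intro exI[of _ "dom h"]) (auto simp: map_le_def)
    then show "\<exists>w\<in>words Z E. germ_eq Z g w x"
      using combination.IH h germ_eq_trans by metis
  qed
qed

lemma words_composition_closed:
  assumes "\<And>e. e \<in> S \<Longrightarrow> local_transformation Z e" "composition_closed S"
  shows "words Z S \<subseteq> insert (Some |` topspace Z) S"
proof
  fix w assume "w \<in> words Z S"
  then show "w \<in> insert (Some |` topspace Z) S"
  proof induction
    case (cons e w)
    then show ?case
      using assms comp_id(1)[OF assms(1), of e] by (auto simp: composition_closed_def)
  qed simp
qed

lemma pseudogroupD:
  assumes "pseudogroup Z H"
  shows "h \<in> H \<Longrightarrow> local_transformation Z h"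
    and "Some |` topspace Z \<in> H"
    and "g \<in> H \<Longrightarrow> h \<in> H \<Longrightarrow> g \<circ>\<^sub>m h \<in> H"
    and "h \<in> H \<Longrightarrow> map_inverse h \<in> H"
    and "h \<in> H \<Longrightarrow> openin Z W \<Longrightarrow> h |` W \<in> H"
  using assms by (auto simp: pseudogroup_def composition_closed_def symmetric_maps_def)

text \<open>
  A pseudogroup without the combination axiom, having the same germs as the pseudogroup \<open>H\<close>. Unlike
  the generating sets in the hypotheses, two such sets can be intersected.
\<close>

definition germ_generating :: "'a topology \<Rightarrow> ('a \<rightharpoonup> 'a) set \<Rightarrow> ('a \<rightharpoonup> 'a) set \<Rightarrow> bool" where
  "germ_generating Z H S \<longleftrightarrow>
     S \<subseteq> H \<and> Some |` topspace Z \<in> S \<and> composition_closed S \<and> symmetric_maps S \<and>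
     (\<forall>h\<in>S. \<forall>W. openin Z W \<longrightarrow> h |` W \<in> S) \<and>
     (\<forall>h\<in>H. \<forall>x\<in>dom h. \<exists>W. openin Z W \<and> x \<in> W \<and> h |` W \<in> S)"

lemma germ_generatingD:
  assumes "germ_generating Z H S"
  shows "h \<in> S \<Longrightarrow> h \<in> H"
    and "Some |` topspace Z \<in> S"
    and "g \<in> S \<Longrightarrow> h \<in> S \<Longrightarrow> g \<circ>\<^sub>m h \<in> S"
    and "h \<in> S \<Longrightarrow> map_inverse h \<in> S"
    and "h \<in> S \<Longrightarrow> openin Z W \<Longrightarrow> h |` W \<in> S"
    and "h \<in> H \<Longrightarrow> x \<in> dom h \<Longrightarrow> \<exists>W. openin Z W \<and> x \<in> W \<and> h |` W \<in> S"
  using assms by (auto simp: germ_generating_def composition_closed_def symmetric_maps_def)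

lemma germ_generating_Int:
  assumes "germ_generating Z H S" "germ_generating Z H T"
  shows "germ_generating Z H (S \<inter> T)"
proof -
  have "\<exists>W. openin Z W \<and> x \<in> W \<and> h |` W \<in> S \<inter> T" if h: "h \<in> H" "x \<in> dom h" for h x
  proof -
    obtain V W where V: "openin Z V" "x \<in> V" "h |` V \<in> S" and W: "openin Z W" "x \<in> W" "h |` W \<in> T"
      using germ_generatingD(6)[OF assms(1) h] germ_generatingD(6)[OF assms(2) h] by blast
    have "h |` (V \<inter> W) \<in> S" "h |` (V \<inter> W) \<in> T"
      using germ_generatingD(5)[OF assms(1) V(3) W(1)] germ_generatingD(5)[OF assms(2) W(3) V(1)]
      by (simp_all add: Int_commute)
    then show ?thesis using V W by blast
  qed
  then show ?thesis
    using assms by (auto simp: germ_generating_def composition_closed_def symmetric_maps_def)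
qed

definition restrictions :: "'a topology \<Rightarrow> ('a \<rightharpoonup> 'a) set \<Rightarrow> ('a \<rightharpoonup> 'a) set" where
  "restrictions Z S = {h |` W | h W. h \<in> insert (Some |` topspace Z) S \<and> openin Z W}"

lemma germ_generating_restrictions:
  assumes H: "pseudogroup Z H" and gen: "generates Z S H"
    and sym: "symmetric_maps S" and comp: "composition_closed S"
  shows "germ_generating Z H (restrictions Z S)"
  unfolding germ_generating_def
proof (intro conjI ballI allI impI)
  note D = pseudogroupD[OF H]
  let ?S = "insert (Some |` topspace Z) S"
  have SH: "h \<in> ?S \<Longrightarrow> h \<in> H" for h
    using gen D(2) by (auto simp: generates_def)
  then have lt: "h \<in> ?S \<Longrightarrow> local_transformation Z h" for h
    using D(1) by blast
  show "restrictions Z S \<subseteq> H"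
    using SH D(5) by (auto simp: restrictions_def)
  have "(Some |` topspace Z) |` topspace Z \<in> restrictions Z S"
    unfolding restrictions_def by blast
  then show "Some |` topspace Z \<in> restrictions Z S"
    by simp
  show "composition_closed (restrictions Z S)"
    unfolding composition_closed_def
  proof (intro ballI)
    fix f g assume "f \<in> restrictions Z S" "g \<in> restrictions Z S"
    then obtain h V k W where f: "f = h |` V" "h \<in> ?S" "openin Z V"
      and g: "g = k |` W" "k \<in> ?S" "openin Z W"
      unfolding restrictions_def by blast
    have "f \<circ>\<^sub>m g = (h \<circ>\<^sub>m k) |` (W \<inter> map_preimage k V)"
      unfolding f g by (rule map_eqI) (auto simp: map_comp_Some restrict_map_Some)
    moreover have "h \<circ>\<^sub>m k \<in> ?S"
      using f g comp comp_id lt by (metis composition_closed_def insert_iff)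
    moreover have "openin Z (W \<inter> map_preimage k V)"
      using local_transformation_preimage[OF lt[OF g(2)] f(3)] g(3) by blast
    ultimately show "f \<circ>\<^sub>m g \<in> restrictions Z S"
      unfolding restrictions_def by blast
  qed
  show "symmetric_maps (restrictions Z S)"
    unfolding symmetric_maps_def
  proof
    fix f assume "f \<in> restrictions Z S"
    then obtain h V where f: "f = h |` V" "h \<in> ?S" "openin Z V"
      unfolding restrictions_def by blast
    have "local_transformation Z f"
      using f lt local_transformation_restrict by blast
    then have "map_inverse f = map_inverse h |` map_image h V"
      using map_inverse_Some_iff[OF lt[OF f(2)]] local_transformation_inj[OF lt[OF f(2)]]
      by (intro map_eqI) (auto simp: map_inverse_Some_iff f(1) restrict_map_Some, metis)
    moreover have "map_inverse h \<in> ?S"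
      using f sym map_inverse_id by (metis insert_iff symmetric_maps_def)
    ultimately show "map_inverse f \<in> restrictions Z S"
      using local_transformation_image[OF lt[OF f(2)] f(3)] unfolding restrictions_def by blast
  qed
next
  fix h W assume "h \<in> restrictions Z S" and W: "openin Z W"
  then obtain k V where k: "h = k |` V" "k \<in> insert (Some |` topspace Z) S" "openin Z V"
    unfolding restrictions_def by blast
  then have "h |` W = k |` (V \<inter> W)" "openin Z (V \<inter> W)"
    using W by auto
  then show "h |` W \<in> restrictions Z S"
    using k(2) unfolding restrictions_def by blast
next
  note D = pseudogroupD[OF H]
  have lt: "h \<in> S \<Longrightarrow> local_transformation Z h" for h
    using D(1) gen by (auto simp: generates_def)
  fix h x assume h: "h \<in> H" "x \<in> dom h"
  then have "h \<in> generated_pseudogroup Z S"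
    using gen by (auto simp: generates_def)
  then obtain w where w: "w \<in> words Z S" "germ_eq Z h w x"
    using generated_germ_word[OF lt sym] h(2) by blast
  then obtain W where W: "openin Z W" "x \<in> W" "\<forall>v\<in>W. h v = w v"
    by (auto simp: germ_eq_def)
  then have "h |` W = w |` W"
    by (auto simp: restrict_map_def)
  then have "h |` W \<in> restrictions Z S"
    using words_composition_closed[OF lt comp] w(1) W(1) unfolding restrictions_def by blast
  then show "\<exists>W. openin Z W \<and> x \<in> W \<and> h |` W \<in> restrictions Z S"
    using W by blast
qed

definition identity_rigid :: "'a topology \<Rightarrow> ('a \<rightharpoonup> 'a) set \<Rightarrow> bool" where
  "identity_rigid Z S \<longleftrightarrow>
     (\<forall>h\<in>S. (\<exists>W. openin Z W \<and> W \<noteq> {} \<and> W \<subseteq> dom h \<and> (\<forall>x\<in>W. h x = Some x)) \<longrightarrow>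
            (\<forall>x\<in>dom h. h x = Some x))"

lemma identity_rigid_restrictions:
  assumes "identity_rigid Z S"
  shows "identity_rigid Z (restrictions Z S)"
  unfolding identity_rigid_def
proof (intro ballI impI)
  fix f x
  assume "f \<in> restrictions Z S" and ex: "\<exists>W. openin Z W \<and> W \<noteq> {} \<and> W \<subseteq> dom f \<and> (\<forall>x\<in>W. f x = Some x)"
    and x: "x \<in> dom f"
  then obtain h V where f: "f = h |` V" "h \<in> insert (Some |` topspace Z) S" "openin Z V"
    unfolding restrictions_def by blast
  obtain W where W: "openin Z W" "W \<noteq> {}" "W \<subseteq> dom f" "\<forall>x\<in>W. f x = Some x"
    using ex by blast
  then have "W \<subseteq> dom h" "\<forall>x\<in>W. h x = Some x"
    by (auto simp: f(1) restrict_map_Some)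
  then have "\<forall>x\<in>dom h. h x = Some x"
    using f(2) W assms unfolding identity_rigid_def
    by (metis domD insert_iff restrict_map_Some)
  then show "f x = Some x"
    using x by (auto simp: f(1) restrict_map_Some)
qed

lemma identity_rigid_germ:
  assumes "identity_rigid Z S" "h \<in> S" "germ_eq Z h Some x" "h y = Some z"
  shows "z = y"
proof -
  obtain W where "openin Z W" "x \<in> W" "\<forall>v\<in>W. h v = Some v"
    using assms(3) by (auto simp: germ_eq_def)
  then have "\<forall>x\<in>dom h. h x = Some x"
    using assms(1,2) unfolding identity_rigid_def by blast
  then show ?thesis using assms(4) by (metis domI option.sel)
qed

section \<open>Uniform extension of germs\<close>

lemma finite_uniform_radius:
  fixes P :: "'b \<Rightarrow> real \<Rightarrow> bool"
  assumes "finite E" and "\<And>e. e \<in> E \<Longrightarrow> \<exists>r>0. P e r"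
    and mono: "\<And>e r r'. P e r \<Longrightarrow> 0 < r' \<Longrightarrow> r' \<le> r \<Longrightarrow> P e r'"
  shows "\<exists>r>0. \<forall>e\<in>E. P e r"
  using assms(1,2)
proof induction
  case empty
  then show ?case by (auto intro: exI[of _ 1])
next
  case (insert e E)
  then obtain r s where "r > 0" "\<forall>e\<in>E. P e r" "s > 0" "P e s" by blast
  then have "min r s > 0 \<and> (\<forall>e\<in>insert e E. P e (min r s))"
    using mono[of _ r "min r s"] mono[of _ s "min r s"] by auto
  then show ?case by blast
qed

lemma compact_uniform_radius:
  fixes P :: "'a \<Rightarrow> real \<Rightarrow> bool"
  assumes "compactin Z C"
    and loc: "\<And>p. p \<in> C \<Longrightarrow> \<exists>N r. openin Z N \<and> p \<in> N \<and> r > 0 \<and> (\<forall>q\<in>N. P q r)"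
    and mono: "\<And>q r r'. P q r \<Longrightarrow> 0 < r' \<Longrightarrow> r' \<le> r \<Longrightarrow> P q r'"
  shows "\<exists>r>0. \<forall>p\<in>C. P p r"
proof -
  let ?\<U> = "{N. openin Z N \<and> (\<exists>r>0. \<forall>q\<in>N. P q r)}"
  have "C \<subseteq> \<Union>?\<U>" using loc by blast
  then obtain \<F> where F: "finite \<F>" "\<F> \<subseteq> ?\<U>" "C \<subseteq> \<Union>\<F>"
    using assms(1) unfolding compactin_def by (metis (no_types, lifting) mem_Collect_eq)
  have "\<exists>r>0. \<forall>N\<in>\<F>. \<forall>q\<in>N. P q r"
    using F(2) by (intro finite_uniform_radius[OF F(1)]) (blast intro: mono)+
  then show ?thesis using F(3) by blast
qed

lemma (in Metric_space) openin_mtopology_iff: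
  "openin mtopology V \<longleftrightarrow> V \<subseteq> M \<and> (\<forall>x\<in>V. \<exists>r>0. \<forall>y\<in>M. d x y < r \<longrightarrow> y \<in> V)"
proof -
  have "mball x r \<subseteq> V \<longleftrightarrow> (\<forall>y\<in>M. d x y < r \<longrightarrow> y \<in> V)" if "x \<in> M" for x r
    using that by (auto simp: subset_iff)
  then show ?thesis
    unfolding openin_mtopology Ball_def by (meson subsetD)
qed

lemma openin_mtopology_of:
  "openin (mtopology_of m) V \<longleftrightarrow>
     V \<subseteq> mspace m \<and> (\<forall>x\<in>V. \<exists>r>0. \<forall>y\<in>mspace m. mdist m x y < r \<longrightarrow> y \<in> V)"
  unfolding mtopology_of_def by (rule Metric_space.openin_mtopology_iff) simp

lemma openin_open_balls_base:
  assumes base: "openin Z = arbitrary union_of (\<lambda>B. B \<in> open_balls F)"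
  shows "B \<in> open_balls F \<Longrightarrow> openin Z B"
    and "openin Z V \<Longrightarrow> x \<in> V \<Longrightarrow> \<exists>B\<in>open_balls F. x \<in> B \<and> B \<subseteq> V"
proof -
  show "B \<in> open_balls F \<Longrightarrow> openin Z B"
    unfolding base by (simp add: arbitrary_union_of_inc)
  show "openin Z V \<Longrightarrow> x \<in> V \<Longrightarrow> \<exists>B\<in>open_balls F. x \<in> B \<and> B \<subseteq> V"
    unfolding base union_of_def by auto
qed

lemma open_balls_openin:
  assumes "B \<in> open_balls F"
  shows "\<exists>m\<in>F. B \<subseteq> mspace m \<and> openin (mtopology_of m) B"
proof -
  obtain m x r where m: "m \<in> F" "B = Metric_space.mball (mspace m) (mdist m) x r"
    using assms by (auto simp: open_balls_def)
  interpret m: Metric_space "mspace m" "mdist m" by simp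
  show ?thesis using m m.mball_subset_mspace by (auto simp: mtopology_of_def)
qed

lemma openin_mtopology_of_ball:
  assumes "m \<in> F" "openin (mtopology_of m) V" "x \<in> V"
  shows "\<exists>B\<in>open_balls F. x \<in> B \<and> B \<subseteq> V"
proof -
  interpret m: Metric_space "mspace m" "mdist m" by simp
  obtain r where "r > 0" "m.mball x r \<subseteq> V"
    using assms(2,3) unfolding mtopology_of_def m.openin_mtopology by blast
  moreover have "x \<in> mspace m"
    using assms openin_subset by fastforce
  moreover have "m.mball x r \<in> open_balls F"
    using assms(1) \<open>r > 0\<close> \<open>x \<in> mspace m\<close> unfolding open_balls_def by blast
  ultimately show ?thesis using \<open>r > 0\<close> m.centre_in_mball_iff by blast
qed

definition compatible_topologies :: "'a metric set \<Rightarrow> bool" where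
  "compatible_topologies F \<longleftrightarrow>
     (\<forall>m\<in>F. \<forall>m'\<in>F. openin (mtopology_of m) (mspace m \<inter> mspace m') \<and>
        (\<forall>V. V \<subseteq> mspace m \<inter> mspace m' \<longrightarrow> openin (mtopology_of m) V \<longrightarrow> openin (mtopology_of m') V))"

lemma quasi_locally_equal_cover_openin:
  "quasi_locally_equal_cover S F \<Longrightarrow> m \<in> F \<Longrightarrow> m' \<in> F \<Longrightarrow>
     openin (mtopology_of m) (mspace m \<inter> mspace m')"
  unfolding quasi_locally_equal_cover_def by blast

lemma quasi_locally_equal_cover_compatible:
  assumes "quasi_locally_equal_cover S F"
  shows "compatible_topologies F"
  unfolding compatible_topologies_def
proof (intro ballI conjI allI impI)
  fix m m' assume m: "m \<in> F" "m' \<in> F"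
  then show "openin (mtopology_of m) (mspace m \<inter> mspace m')"
    using quasi_locally_equal_cover_openin[OF assms] by blast
  fix V assume V: "V \<subseteq> mspace m \<inter> mspace m'" "openin (mtopology_of m) V"
  obtain \<delta> :: "real \<Rightarrow> real" where \<delta>: "\<forall>\<epsilon>>0. \<delta> \<epsilon> > 0" and
    U: "\<forall>m\<in>F. \<forall>m'\<in>F. \<forall>z \<in> mspace m \<inter> mspace m'.
           \<exists>U. openin (mtopology_of m) U \<and> openin (mtopology_of m') U \<and>
               z \<in> U \<and> U \<subseteq> mspace m \<inter> mspace m' \<and>
               (\<forall>\<epsilon>>0. \<forall>x\<in>U. \<forall>y\<in>U. mdist m x y < \<delta> \<epsilon> \<longrightarrow> mdist m' x y < \<epsilon>)"
    using assms unfolding quasi_locally_equal_cover_def by (elim conjE exE) (rule that)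
  show "openin (mtopology_of m') V"
    unfolding openin_mtopology_of
  proof (intro conjI ballI)
    show "V \<subseteq> mspace m'" using V by blast
    fix x assume x: "x \<in> V"
    then obtain e where e: "e > 0" "\<forall>y\<in>mspace m. mdist m x y < e \<longrightarrow> y \<in> V"
      using V by (auto simp: openin_mtopology_of)
    have "x \<in> mspace m' \<inter> mspace m" using x V by blast
    then obtain U where U: "openin (mtopology_of m') U" "x \<in> U"
      "\<forall>\<epsilon>>0. \<forall>x\<in>U. \<forall>y\<in>U. mdist m' x y < \<delta> \<epsilon> \<longrightarrow> mdist m x y < \<epsilon>"
      using U[THEN bspec, OF m(2), THEN bspec, OF m(1), THEN bspec, OF \<open>x \<in> mspace m' \<inter> mspace m\<close>]
      by (elim conjE exE) (rule that)
    have "openin (mtopology_of m') (U \<inter> (mspace m' \<inter> mspace m))"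
      using openin_Int[OF U(1) quasi_locally_equal_cover_openin[OF assms m(2,1)]] .
    then obtain r where r: "r > 0" "\<forall>y\<in>mspace m'. mdist m' x y < r \<longrightarrow> y \<in> U \<inter> (mspace m' \<inter> mspace m)"
      using x U V unfolding openin_mtopology_of by blast
    show "\<exists>r>0. \<forall>y\<in>mspace m'. mdist m' x y < r \<longrightarrow> y \<in> V"
      using r e U \<delta> by (intro exI[of _ "min r (\<delta> e)"]) auto
  qed
qed

lemma compatible_openin_iff:
  assumes F: "compatible_topologies F" and base: "openin Z = arbitrary union_of (\<lambda>B. B \<in> open_balls F)"
    and m: "m \<in> F"
  shows "openin (mtopology_of m) V \<longleftrightarrow> openin Z V \<and> V \<subseteq> mspace m"
proof
  assume V: "openin (mtopology_of m) V"
  have "\<forall>x\<in>V. \<exists>B. openin Z B \<and> x \<in> B \<and> B \<subseteq> V"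
    using openin_mtopology_of_ball[OF m V] openin_open_balls_base(1)[OF base] by meson
  then have "openin Z V" using openin_subopen[of Z V] by simp
  then show "openin Z V \<and> V \<subseteq> mspace m" using openin_subset[OF V] by simp
next
  assume V: "openin Z V \<and> V \<subseteq> mspace m"
  have "\<exists>B. openin (mtopology_of m) B \<and> x \<in> B \<and> B \<subseteq> V" if x: "x \<in> V" for x
  proof -
    obtain B where B: "B \<in> open_balls F" "x \<in> B" "B \<subseteq> V"
      using openin_open_balls_base(2)[OF base _ x] V by blast
    then obtain m' where "m' \<in> F" "B \<subseteq> mspace m'" "openin (mtopology_of m') B"
      using open_balls_openin by blast
    moreover have "B \<subseteq> mspace m" using B V by blast
    ultimately have "openin (mtopology_of m) B"
      using F m unfolding compatible_topologies_def by (metis le_inf_iff)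
    then show ?thesis using B by blast
  qed
  then show "openin (mtopology_of m) V" using openin_subopen[of "mtopology_of m" V] by simp
qed

context Metric_space
begin

lemma equicontinuous_on_compact:
  assumes cover: "quasi_locally_equal_cover M F"
    and base: "openin mtopology = arbitrary union_of (\<lambda>B. B \<in> open_balls F)"
    and K: "compactin mtopology K"
    and lt: "\<And>h. h \<in> S \<Longrightarrow> local_transformation mtopology h"
    and equi: "\<And>\<epsilon>::real. \<epsilon> > 0 \<Longrightarrow> \<exists>\<delta>::real. \<delta> > 0 \<and>
              (\<forall>h\<in>S. \<forall>m\<in>F. \<forall>m'\<in>F.
                 \<forall>x \<in> mspace m \<inter> map_preimage h (mspace m' \<inter> ran h).
                 \<forall>y \<in> mspace m \<inter> map_preimage h (mspace m' \<inter> ran h).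
                   mdist m x y < \<delta> \<longrightarrow> mdist m' (the (h x)) (the (h y)) < \<epsilon>)"
  shows "\<exists>\<eta>>0. \<forall>\<epsilon>>0. \<exists>\<delta>>0. \<forall>s\<in>restrictions mtopology S. \<forall>x x' y y'.
           s x = Some x' \<longrightarrow> s y = Some y' \<longrightarrow> x \<in> K \<longrightarrow> x' \<in> K \<longrightarrow>
           d x y < \<delta> \<longrightarrow> d x' y' < \<eta> \<longrightarrow> d x' y' < \<epsilon>"
proof -
  note op = compatible_openin_iff[OF quasi_locally_equal_cover_compatible[OF cover] base]
  have KM: "K \<subseteq> M" using compactin_subset_topspace[OF K] by simp
  have cov: "\<exists>m\<in>F. p \<in> mspace m" if "p \<in> K" for p
    using cover that KM by (auto simp: quasi_locally_equal_cover_def)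
  have space: "openin mtopology (mspace m)" if "m \<in> F" for m
    using op[OF that, of "mspace m"] openin_topspace[of "mtopology_of m"] by simp
  have dist_small: "\<exists>N r. openin mtopology N \<and> p \<in> N \<and> r > 0 \<and>
      (\<forall>q\<in>N. \<forall>v\<in>M. d q v < r \<longrightarrow> v \<in> V)" if "openin mtopology V" "p \<in> V" for V p
  proof -
    obtain r where r: "r > 0" "\<forall>v\<in>M. d p v < r \<longrightarrow> v \<in> V" and "p \<in> M"
      using \<open>openin mtopology V\<close> \<open>p \<in> V\<close> unfolding openin_mtopology_iff by blast
    have "\<forall>q\<in>mball p (r/2). \<forall>v\<in>M. d q v < r/2 \<longrightarrow> v \<in> V"
    proof (intro ballI impI)
      fix q v assume "q \<in> mball p (r/2)" "v \<in> M" "d q v < r/2"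
      then have "d p v < r" using triangle[of p q v] by simp
      then show "v \<in> V" using r \<open>v \<in> M\<close> by blast
    qed
    then show ?thesis using r(1) \<open>p \<in> M\<close>
      by (intro exI[of _ "mball p (r/2)"] exI[of _ "r/2"]) auto
  qed
  have loc_\<eta>: "\<exists>\<eta>>0. \<forall>p\<in>K. \<exists>m\<in>F. \<forall>v\<in>M. d p v < \<eta> \<longrightarrow> v \<in> mspace m"
  proof (rule compact_uniform_radius[OF K])
    fix p assume p: "p \<in> K"
    obtain m where "m \<in> F" "p \<in> mspace m" using cov[OF p] by blast
    then show "\<exists>N r. openin mtopology N \<and> p \<in> N \<and> r > 0 \<and>
        (\<forall>q\<in>N. \<exists>m\<in>F. \<forall>v\<in>M. d q v < r \<longrightarrow> v \<in> mspace m)"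
      using dist_small[OF space] by meson
  next
    fix q and r r' :: real
    assume "\<exists>m\<in>F. \<forall>v\<in>M. d q v < r \<longrightarrow> v \<in> mspace m" "r' \<le> r"
    then show "\<exists>m\<in>F. \<forall>v\<in>M. d q v < r' \<longrightarrow> v \<in> mspace m"
      by (meson order_less_le_trans)
  qed
  then obtain \<eta> where \<eta>: "\<eta> > 0" "\<forall>p\<in>K. \<exists>m\<in>F. \<forall>v\<in>M. d p v < \<eta> \<longrightarrow> v \<in> mspace m"
    by blast
  have source: "\<exists>\<delta>>0. \<forall>p\<in>K. \<exists>m\<in>F. \<forall>v\<in>M. d p v < \<delta> \<longrightarrow> v \<in> mspace m \<and> mdist m p v < a"
    if a: "a > 0" for a
  proof (rule compact_uniform_radius[OF K])
    fix p assume p: "p \<in> K"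
    obtain m where m: "m \<in> F" "p \<in> mspace m" using cov[OF p] by blast
    interpret m: Metric_space "mspace m" "mdist m" by simp
    have "openin mtopology (m.mball p (a/2))"
      using op[OF m(1)] m.openin_mball by (metis mtopology_of_def)
    then obtain N r where N: "openin mtopology N" "p \<in> N" "r > 0"
      "\<forall>q\<in>N. \<forall>v\<in>M. d q v < r \<longrightarrow> v \<in> m.mball p (a/2)"
      using dist_small m a by (metis m.centre_in_mball_iff half_gt_zero)
    have "v \<in> mspace m \<and> mdist m q v < a" if "q \<in> N" "v \<in> M" "d q v < r" for q v
    proof -
      have "q \<in> M" using N(1) that(1) openin_subset by fastforce
      then have "q \<in> m.mball p (a/2)" "v \<in> m.mball p (a/2)" using N that by auto
      then show ?thesis using m.triangle''[of q p v] by simp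
    qed
    then show "\<exists>N r. openin mtopology N \<and> p \<in> N \<and> r > 0 \<and>
        (\<forall>q\<in>N. \<exists>m\<in>F. \<forall>v\<in>M. d q v < r \<longrightarrow> v \<in> mspace m \<and> mdist m q v < a)"
      using N(1-3) m(1) by blast
  next
    fix q and r r' :: real
    assume "\<exists>m\<in>F. \<forall>v\<in>M. d q v < r \<longrightarrow> v \<in> mspace m \<and> mdist m q v < a" "r' \<le> r"
    then show "\<exists>m\<in>F. \<forall>v\<in>M. d q v < r' \<longrightarrow> v \<in> mspace m \<and> mdist m q v < a"
      by (meson order_less_le_trans)
  qed
  have target: "\<exists>a>0. \<forall>p\<in>K. \<exists>m\<in>F. \<forall>v\<in>M. d p v < \<eta>/2 \<longrightarrow>
      p \<in> mspace m \<and> v \<in> mspace m \<and> (mdist m p v < a \<longrightarrow> d p v < \<epsilon>)"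
    if \<epsilon>: "\<epsilon> > 0" for \<epsilon>
  proof (rule compact_uniform_radius[OF K])
    fix p assume p: "p \<in> K"
    then have pM: "p \<in> M" using KM by blast
    obtain m where m: "m \<in> F" and sub: "\<forall>v\<in>M. d p v < \<eta> \<longrightarrow> v \<in> mspace m"
      using \<eta> p by blast
    have pm: "p \<in> mspace m" using sub pM \<eta>(1) by simp
    interpret m: Metric_space "mspace m" "mdist m" by simp
    have "openin mtopology (mball p (\<epsilon>/2) \<inter> mspace m)"
      using space[OF m] by (intro openin_Int) auto
    then have "openin (mtopology_of m) (mball p (\<epsilon>/2) \<inter> mspace m)"
      using op[OF m] by simp
    then obtain r where r: "r > 0" "\<forall>v\<in>mspace m. mdist m p v < r \<longrightarrow> v \<in> mball p (\<epsilon>/2)"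
      using pm pM \<epsilon> unfolding openin_mtopology_of
      by (metis IntD1 IntI centre_in_mball_iff half_gt_zero)
    let ?N = "m.mball p (r/2) \<inter> mball p (min (\<epsilon>/2) (\<eta>/2))"
    have "openin mtopology (m.mball p (r/2))"
      using op[OF m] m.openin_mball by (metis mtopology_of_def)
    then have N: "openin mtopology ?N" "p \<in> ?N"
      using pm pM r \<epsilon> \<eta> by auto
    have "q \<in> mspace m \<and> v \<in> mspace m \<and> (mdist m q v < r/2 \<longrightarrow> d q v < \<epsilon>)"
      if "q \<in> ?N" "v \<in> M" "d q v < \<eta>/2" for q v
    proof (intro conjI impI)
      have "d p v < \<eta>" using triangle[of p q v] that by simp
      then show v: "v \<in> mspace m" using sub that by blast
      show "q \<in> mspace m" using that by simp
      assume "mdist m q v < r/2"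
      then have "mdist m p v < r" using m.triangle[of p q v] that v by simp
      then have "d p v < \<epsilon>/2" using r v by simp
      then show "d q v < \<epsilon>" using triangle''[of q p v] that by simp
    qed
    then show "\<exists>N r. openin mtopology N \<and> p \<in> N \<and> r > 0 \<and>
        (\<forall>q\<in>N. \<exists>m\<in>F. \<forall>v\<in>M. d q v < \<eta>/2 \<longrightarrow>
           q \<in> mspace m \<and> v \<in> mspace m \<and> (mdist m q v < r \<longrightarrow> d q v < \<epsilon>))"
      using N m r(1) by (intro exI[of _ ?N] exI[of _ "r/2"]) (meson half_gt_zero)
  next
    fix q and r r' :: real
    assume "\<exists>m\<in>F. \<forall>v\<in>M. d q v < \<eta>/2 \<longrightarrow>
      q \<in> mspace m \<and> v \<in> mspace m \<and> (mdist m q v < r \<longrightarrow> d q v < \<epsilon>)" "r' \<le> r"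
    then show "\<exists>m\<in>F. \<forall>v\<in>M. d q v < \<eta>/2 \<longrightarrow>
      q \<in> mspace m \<and> v \<in> mspace m \<and> (mdist m q v < r' \<longrightarrow> d q v < \<epsilon>)"
      by (meson order_less_le_trans)
  qed
  have "\<exists>\<delta>>0. \<forall>s\<in>restrictions mtopology S. \<forall>x x' y y'.
           s x = Some x' \<longrightarrow> s y = Some y' \<longrightarrow> x \<in> K \<longrightarrow> x' \<in> K \<longrightarrow>
           d x y < \<delta> \<longrightarrow> d x' y' < \<eta>/2 \<longrightarrow> d x' y' < \<epsilon>" if \<epsilon>: "\<epsilon> > 0" for \<epsilon>
  proof -
    obtain a where a: "a > 0" and A: "\<forall>p\<in>K. \<exists>m\<in>F. \<forall>v\<in>M. d p v < \<eta>/2 \<longrightarrow>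
      p \<in> mspace m \<and> v \<in> mspace m \<and> (mdist m p v < a \<longrightarrow> d p v < \<epsilon>)"
      using target[OF \<epsilon>] by blast
    obtain b where b: "b > 0" and B: "\<And>h m m' x y. h \<in> S \<Longrightarrow> m \<in> F \<Longrightarrow> m' \<in> F \<Longrightarrow>
      x \<in> mspace m \<inter> map_preimage h (mspace m' \<inter> ran h) \<Longrightarrow>
      y \<in> mspace m \<inter> map_preimage h (mspace m' \<inter> ran h) \<Longrightarrow>
      mdist m x y < b \<Longrightarrow> mdist m' (the (h x)) (the (h y)) < a"
      using equi[OF a] by meson
    obtain c where c: "c > 0" and C: "\<forall>p\<in>K. \<exists>m\<in>F. \<forall>v\<in>M. d p v < c \<longrightarrow> v \<in> mspace m \<and> mdist m p v < b"
      using source[OF b] by blast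
    have "d x' y' < \<epsilon>" if s: "s \<in> restrictions mtopology S" "s x = Some x'" "s y = Some y'"
      and K: "x \<in> K" "x' \<in> K" and xy: "d x y < min c \<epsilon>" and xy': "d x' y' < \<eta>/2" for s x x' y y'
    proof -
      obtain h W where "s = h |` W" "h \<in> insert (Some |` M) S"
        using s(1) by (auto simp: restrictions_def)
      then have h: "h \<in> insert (Some |` M) S" "h x = Some x'" "h y = Some y'"
        using s by (auto simp: restrict_map_Some)
      show ?thesis
      proof (cases "h \<in> S")
        case False
        then show ?thesis using h xy by (auto simp: restrict_map_Some)
      next
        case True
        have in_M: "x \<in> M" "x' \<in> M" "y \<in> M" "y' \<in> M"
          using local_transformation_in_topspace[OF lt[OF True]] h by auto
        obtain m where m: "m \<in> F" "\<forall>v\<in>M. d x v < c \<longrightarrow> v \<in> mspace m \<and> mdist m x v < b"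
          using C K by blast
        obtain m' where m': "m' \<in> F" "\<forall>v\<in>M. d x' v < \<eta>/2 \<longrightarrow>
            x' \<in> mspace m' \<and> v \<in> mspace m' \<and> (mdist m' x' v < a \<longrightarrow> d x' v < \<epsilon>)"
          using A K by blast
        have "x \<in> mspace m" "y \<in> mspace m" "mdist m x y < b" "x' \<in> mspace m'" "y' \<in> mspace m'"
          using m m' in_M c xy xy' by auto
        then have "mdist m' x' y' < a"
          using B[OF True m(1) m'(1), of x y] h by (auto intro: ranI)
        then show ?thesis using m' in_M xy' by blast
      qed
    qed
    then show ?thesis using c \<epsilon> by (intro exI[of _ "min c \<epsilon>"]) simp
  qed
  then show ?thesis using \<eta>(1) by (intro exI[of _ "\<eta>/2"]) simp
qed

text \<open>
  A germ is a word in the generators \<open>e\<close>. Along the word, equicontinuity keeps the images of a small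
  ball so small that the next generator, which extends beyond its domain, can be applied to them.
\<close>

lemma uniform_extension:
  assumes H: "pseudogroup mtopology H" and S: "germ_generating mtopology H S"
    and U: "openin mtopology U" and K: "compactin mtopology (mtopology closure_of U)"
    and E: "finite E" "symmetric_maps E"
      "generates (subtopology mtopology U) E (pseudogroup_restriction H U)"
    and ext: "\<And>e. e \<in> E \<Longrightarrow> \<exists>e'\<in>H. mtopology closure_of dom e \<subseteq> dom e' \<and> e = e' |` dom e"
    and equi: "\<exists>\<eta>>0. \<forall>\<epsilon>>0. \<exists>\<delta>>0. \<forall>s\<in>S. \<forall>x x' y y'. s x = Some x' \<longrightarrow> s y = Some y' \<longrightarrow>
           x \<in> mtopology closure_of U \<longrightarrow> x' \<in> mtopology closure_of U \<longrightarrow>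
           d x y < \<delta> \<longrightarrow> d x' y' < \<eta> \<longrightarrow> d x' y' < \<epsilon>"
    and "\<epsilon> > 0"
  shows "\<exists>\<delta>>0. \<forall>x\<in>U. \<forall>g\<in>H. \<forall>y\<in>U. g x = Some y \<longrightarrow>
           (\<exists>s\<in>S. dom s = mball x \<delta> \<and> germ_eq mtopology s g x \<and> ran s \<subseteq> mball y \<epsilon>)"
proof -
  note HD = pseudogroupD[OF H] and SD = germ_generatingD[OF S]
  have UM: "U \<subseteq> M" using openin_subset[OF U] by simp
  have UK: "U \<subseteq> mtopology closure_of U"
    by (simp add: UM closure_of_subset)
  have EH: "e \<in> H" "dom e \<subseteq> U" "ran e \<subseteq> U" if "e \<in> E" for e
    using E(3) that by (auto simp: generates_def pseudogroup_restriction_def)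
  have ltE: "local_transformation (subtopology mtopology U) e" if "e \<in> E" for e
    using local_transformation_subtopology[OF U HD(1)] EH[OF that] by blast
  obtain \<eta> where \<eta>: "\<eta> > 0" and equi: "\<And>\<epsilon>. \<epsilon> > 0 \<Longrightarrow> \<exists>\<delta>>0. \<forall>s\<in>S. \<forall>x x' y y'.
       s x = Some x' \<longrightarrow> s y = Some y' \<longrightarrow>
       x \<in> mtopology closure_of U \<longrightarrow> x' \<in> mtopology closure_of U \<longrightarrow>
       d x y < \<delta> \<longrightarrow> d x' y' < \<eta> \<longrightarrow> d x' y' < \<epsilon>"
    using equi by blast
  define P where "P e r \<longleftrightarrow> (\<forall>p\<in>dom e. \<exists>b\<in>S. germ_eq mtopology b e p \<and>
     (\<forall>v\<in>mball p r. \<exists>v'. b v = Some v' \<and> d (the (e p)) v' < \<eta>))" for e r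
  have "\<exists>r>0. \<forall>e\<in>E. P e r"
  proof (rule finite_uniform_radius[OF E(1)])
    fix e assume e: "e \<in> E"
    obtain e' where e': "e' \<in> H" "mtopology closure_of dom e \<subseteq> dom e'" "e = e' |` dom e"
      using ext[OF e] by blast
    have "compactin mtopology (mtopology closure_of dom e)"
      using K closed_compactin closure_of_mono[OF EH(2)[OF e]] closedin_closure_of by metis
    then have ex: "\<exists>r>0. \<forall>p\<in>mtopology closure_of dom e. \<exists>b\<in>S. germ_eq mtopology b e' p \<and>
     (\<forall>v\<in>mball p r. \<exists>v'. b v = Some v' \<and> d (the (e' p)) v' < \<eta>)"
    proof (rule compact_uniform_radius)
      fix p assume "p \<in> mtopology closure_of dom e"
      then obtain q where q: "e' p = Some q" using e' by blast
      then obtain W where W: "openin mtopology W" "p \<in> W" "e' |` W \<in> S"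
        using SD(6)[OF e'(1)] by blast
      have qM: "q \<in> M" "p \<in> M"
        using local_transformation_in_topspace[OF HD(1)[OF e'(1)] q] by auto
      have "openin mtopology (W \<inter> map_preimage e' (mball q (\<eta>/2)))"
        using local_transformation_preimage[OF HD(1)[OF e'(1)]] W by blast
      moreover have "p \<in> W \<inter> map_preimage e' (mball q (\<eta>/2))"
        using W q qM \<eta> by simp
      ultimately obtain r where r: "r > 0" "mball p r \<subseteq> W \<inter> map_preimage e' (mball q (\<eta>/2))"
        unfolding openin_mtopology by blast
      have "germ_eq mtopology (e' |` W) e' p' \<and>
          (\<forall>v\<in>mball p' (r/2). \<exists>v'. (e' |` W) v = Some v' \<and> d (the (e' p')) v' < \<eta>)"
        if p': "p' \<in> mball p (r/2)" for p'
      proof (intro conjI ballI)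
        have "p' \<in> mball p r" using p' mball_subset_concentric[of "r/2" r p] r(1) by auto
        then have 1: "p' \<in> W" "p' \<in> map_preimage e' (mball q (\<eta>/2))" using r by blast+
        show "germ_eq mtopology (e' |` W) e' p'" by (rule germ_eq_restrict[OF W(1) 1(1)])
        fix v assume "v \<in> mball p' (r/2)"
        then have "v \<in> mball p r" using p' triangle[of p p' v] by simp
        then have v: "v \<in> W" "v \<in> map_preimage e' (mball q (\<eta>/2))" using r by blast+
        then obtain v' u where u: "e' v = Some v'" "e' p' = Some u" "v' \<in> mball q (\<eta>/2)" "u \<in> mball q (\<eta>/2)"
          using 1(2) unfolding in_map_preimage_iff by blast
        then have "d u v' < \<eta>" using triangle''[of u q v'] by simp
        then show "\<exists>v'. (e' |` W) v = Some v' \<and> d (the (e' p')) v' < \<eta>"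
          using u v(1) by (simp add: restrict_map_Some)
      qed
      then have "\<forall>p'\<in>mball p (r/2). \<exists>b\<in>S. germ_eq mtopology b e' p' \<and>
          (\<forall>v\<in>mball p' (r/2). \<exists>v'. b v = Some v' \<and> d (the (e' p')) v' < \<eta>)"
        using W(3) by blast
      moreover have "openin mtopology (mball p (r/2)) \<and> p \<in> mball p (r/2) \<and> r/2 > 0"
        using r(1) qM by simp
      ultimately show "\<exists>N r. openin mtopology N \<and> p \<in> N \<and> r > 0 \<and> (\<forall>p\<in>N. \<exists>b\<in>S. germ_eq mtopology b e' p \<and>
          (\<forall>v\<in>mball p r. \<exists>v'. b v = Some v' \<and> d (the (e' p)) v' < \<eta>))"
        by blast
    next
      fix p and r r' :: real assume "\<exists>b\<in>S. germ_eq mtopology b e' p \<and>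
          (\<forall>v\<in>mball p r. \<exists>v'. b v = Some v' \<and> d (the (e' p)) v' < \<eta>)" "r' \<le> r"
      then show "\<exists>b\<in>S. germ_eq mtopology b e' p \<and>
          (\<forall>v\<in>mball p r'. \<exists>v'. b v = Some v' \<and> d (the (e' p)) v' < \<eta>)"
        using mball_subset_concentric by blast
    qed
    have in_dom: "germ_eq mtopology e' e p" "e' p = e p" "p \<in> mtopology closure_of dom e"
      if "p \<in> dom e" for p
    proof -
      have "openin mtopology (dom e)"
        using HD(1)[OF EH(1)[OF e]] local_transformation_open_dom by blast
      then show "germ_eq mtopology e' e p" using that e'(3) germ_eq_restrict germ_eq_sym by metis
      then show "e' p = e p" by (rule germ_eq_at)
      show "p \<in> mtopology closure_of dom e"
        using that closure_of_subset[OF openin_subset[OF \<open>openin mtopology (dom e)\<close>]] by blast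
    qed
    obtain r where r: "r > 0" "\<forall>p\<in>mtopology closure_of dom e. \<exists>b\<in>S. germ_eq mtopology b e' p \<and>
     (\<forall>v\<in>mball p r. \<exists>v'. b v = Some v' \<and> d (the (e' p)) v' < \<eta>)"
      using ex by blast
    have "P e r"
      unfolding P_def
    proof
      fix p assume p: "p \<in> dom e"
      obtain b where "b \<in> S" "germ_eq mtopology b e' p"
        "\<forall>v\<in>mball p r. \<exists>v'. b v = Some v' \<and> d (the (e' p)) v' < \<eta>"
        using r(2)[THEN bspec, OF in_dom(3)[OF p]] by blast
      then show "\<exists>b\<in>S. germ_eq mtopology b e p \<and>
          (\<forall>v\<in>mball p r. \<exists>v'. b v = Some v' \<and> d (the (e p)) v' < \<eta>)"
        using germ_eq_trans[OF _ in_dom(1)[OF p]] in_dom(2)[OF p] by (intro bexI[of _ b]) auto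
    qed
    then show "\<exists>r>0. P e r" using r(1) by blast
  next
    fix e and r r' :: real assume "P e r" "r' \<le> r"
    then show "P e r'"
      unfolding P_def using mball_subset_concentric by blast
  qed
  then obtain r where r: "r > 0" "\<And>e. e \<in> E \<Longrightarrow> P e r" by blast
  define \<epsilon>' where "\<epsilon>' = min \<epsilon> r"
  have \<epsilon>': "\<epsilon>' > 0" "\<epsilon>' \<le> \<epsilon>" "\<epsilon>' \<le> r" using r \<open>\<epsilon> > 0\<close> by (auto simp: \<epsilon>'_def)
  obtain \<delta>' where \<delta>': "\<delta>' > 0" and small: "\<forall>s\<in>S. \<forall>x x' y y'.
       s x = Some x' \<longrightarrow> s y = Some y' \<longrightarrow>
       x \<in> mtopology closure_of U \<longrightarrow> x' \<in> mtopology closure_of U \<longrightarrow>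
       d x y < \<delta>' \<longrightarrow> d x' y' < \<eta> \<longrightarrow> d x' y' < \<epsilon>'"
    using equi[OF \<epsilon>'(1)] by (elim exE conjE) (rule that)
  have equi': "d x' y' < \<epsilon>'" if "s \<in> S" "s x = Some x'" "s y = Some y'" "x \<in> U" "x' \<in> U"
       "d x y < \<delta>'" "d x' y' < \<eta>" for s x x' y y'
    using small[rule_format, OF that(1-3) subsetD[OF UK that(4)] subsetD[OF UK that(5)] that(6,7)] .
  define \<delta> where "\<delta> = min \<delta>' \<epsilon>'"
  have \<delta>: "\<delta> > 0" "\<delta> \<le> \<delta>'" "\<delta> \<le> \<epsilon>'" using \<delta>' \<epsilon>' by (auto simp: \<delta>_def)
  have word: "w x = Some y \<Longrightarrow>
      \<exists>s\<in>S. dom s = mball x \<delta> \<and> germ_eq mtopology s w x \<and> ran s \<subseteq> mball y \<epsilon>'"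
    if x: "x \<in> U" and w: "w \<in> words (subtopology mtopology U) E" for x y w
    using w
  proof (induction arbitrary: y)
    case empty
    have "topspace (subtopology mtopology U) = U" using UM by auto
    with empty have "y = x" by (simp add: restrict_map_Some)
    let ?s = "(Some |` M) |` mball x \<delta>"
    have "?s \<in> S" using SD(5)[OF SD(2) openin_mball] by simp
    moreover have "dom ?s = mball x \<delta>" by auto
    moreover have "germ_eq mtopology ?s (Some |` topspace (subtopology mtopology U)) x"
      unfolding germ_eq_def using x U \<delta> UM
      by (intro exI[of _ "mball x \<delta> \<inter> U"]) (auto simp: restrict_map_def)
    moreover have "ran ?s \<subseteq> mball y \<epsilon>'"
      using \<delta> \<open>y = x\<close> by (auto simp: ran_def restrict_map_Some)
    ultimately show ?case by blast
  next
    case (cons e w)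
    then obtain z where z: "w x = Some z" "e z = Some y" by (auto simp: map_comp_Some)
    obtain s where s: "s \<in> S" "dom s = mball x \<delta>" "germ_eq mtopology s w x" "ran s \<subseteq> mball z \<epsilon>'"
      using cons.IH[OF z(1)] by blast
    obtain b where b: "b \<in> S" "germ_eq mtopology b e z"
      "\<forall>v\<in>mball z r. \<exists>v'. b v = Some v' \<and> d y v' < \<eta>"
      using r(2)[OF cons.hyps(1)] z(2) unfolding P_def by (metis domI option.sel)
    have s_x: "s x = Some z" using germ_eq_at[OF s(3)] z by simp
    have y: "y \<in> U" using z(2) EH(3)[OF cons.hyps(1)] by (auto intro: ranI)
    let ?s = "b \<circ>\<^sub>m s"
    have "?s \<in> S" using SD(3) b s by blast
    have step: "\<exists>u v'. s v = Some u \<and> ?s v = Some v' \<and> d y v' < \<eta>" if v: "v \<in> mball x \<delta>" for v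
    proof -
      obtain u where u: "s v = Some u" using v s(2) by blast
      then have "u \<in> mball z \<epsilon>'" using s(4) by (auto intro: ranI)
      then have "u \<in> mball z r" using \<epsilon>' by simp
      then show ?thesis using b(3) u by (auto simp: map_comp_Some)
    qed
    have "dom ?s = mball x \<delta>"
    proof
      show "dom ?s \<subseteq> mball x \<delta>" unfolding s(2)[symmetric] by (auto simp: map_comp_Some)
      show "mball x \<delta> \<subseteq> dom ?s" using step by blast
    qed
    moreover have "germ_eq mtopology ?s (e \<circ>\<^sub>m w) x"
      using germ_eq_comp[OF b(2) s(3) HD(1)[OF SD(1)[OF s(1)]] s_x] .
    moreover have "ran ?s \<subseteq> mball y \<epsilon>'"
    proof
      fix v' assume "v' \<in> ran ?s"
      then obtain v where v: "?s v = Some v'" by (auto simp: ran_def)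
      then have vx: "v \<in> mball x \<delta>" using \<open>dom ?s = mball x \<delta>\<close> by blast
      then have "d y v' < \<eta>" using step v by fastforce
      moreover have "?s x = Some y"
        using germ_eq_at[OF \<open>germ_eq mtopology ?s (e \<circ>\<^sub>m w) x\<close>] cons.prems by simp
      ultimately have "d y v' < \<epsilon>'"
        using equi'[OF \<open>?s \<in> S\<close> _ v x y] vx \<delta> by simp
      then show "v' \<in> mball y \<epsilon>'"
        using y UM local_transformation_in_topspace[OF HD(1)[OF SD(1)[OF \<open>?s \<in> S\<close>]] v] by auto
    qed
    ultimately show ?case using \<open>?s \<in> S\<close> by blast
  qed
  have "\<exists>s\<in>S. dom s = mball x \<delta> \<and> germ_eq mtopology s g x \<and> ran s \<subseteq> mball y \<epsilon>"
    if xy: "x \<in> U" "g \<in> H" "y \<in> U" "g x = Some y" for x g y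
  proof -
    define V where "V = U \<inter> map_preimage g U"
    have V: "openin mtopology V" "x \<in> V"
      unfolding V_def using local_transformation_preimage[OF HD(1)] xy U by auto
    have "g |` V \<in> pseudogroup_restriction H U"
      using HD(5)[OF xy(2) V(1)] unfolding pseudogroup_restriction_def
      by (auto simp: V_def restrict_map_Some ran_def)
    then have gV: "g |` V \<in> generated_pseudogroup (subtopology mtopology U) E"
      using E(3) by (auto simp: generates_def)
    have "x \<in> dom (g |` V)" using V(2) xy(4) by (auto simp: restrict_map_def)
    then obtain w where w: "w \<in> words (subtopology mtopology U) E"
      "germ_eq (subtopology mtopology U) (g |` V) w x"
      using generated_germ_word[OF ltE E(2) gV] by blast
    have "germ_eq mtopology (g |` V) w x"
      using w(2) openin_open_subtopology[OF U] unfolding germ_eq_def by auto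
    then have gw: "germ_eq mtopology w g x"
      using germ_eq_restrict[OF V] germ_eq_sym germ_eq_trans by metis
    then have "w x = Some y" using germ_eq_at xy by metis
    then obtain s where "s \<in> S" "dom s = mball x \<delta>" "germ_eq mtopology s w x" "ran s \<subseteq> mball y \<epsilon>'"
      using word[OF xy(1) w(1)] by blast
    then show ?thesis
      using germ_eq_trans[OF _ gw] order_trans[OF _ mball_subset_concentric[OF \<epsilon>'(2)]]
      by (intro bexI[of _ s]) auto
  qed
  then show ?thesis using \<delta>(1) by blast
qed

end

section \<open>The invariant metrics\<close>

lemma germ_eq_inverse_comp:
  assumes "local_transformation Z h" "h x = Some y"
  shows "germ_eq Z (map_inverse h \<circ>\<^sub>m h) Some x"
  unfolding germ_eq_def using assms local_transformation_open_dom[OF assms(1)]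
  by (intro exI[of _ "dom h"]) (auto simp: map_comp_def map_inverse_Some_iff)

lemma germ_eq_comp_inverse_comp:
  assumes "local_transformation Z h" "h x = Some y"
  shows "germ_eq Z ((g \<circ>\<^sub>m map_inverse h) \<circ>\<^sub>m h) g x"
  unfolding germ_eq_def
proof (intro exI[of _ "dom h"] conjI ballI)
  fix v assume "v \<in> dom h"
  then obtain w where w: "h v = Some w" by blast
  then have "map_inverse h w = Some v" by (simp add: map_inverse_Some_iff[OF assms(1)])
  then show "((g \<circ>\<^sub>m map_inverse h) \<circ>\<^sub>m h) v = g v" using w by simp
qed (use assms local_transformation_open_dom in auto)

locale germ_extension = Metric_space M d for M :: "'a set" and d +
  fixes H S :: "('a \<rightharpoonup> 'a) set" and U :: "'a set"
  assumes H: "pseudogroup mtopology H" and S: "germ_generating mtopology H S"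
    and rigid: "identity_rigid mtopology S"
    and U: "openin mtopology U"
    and orbits: "x \<in> M \<Longrightarrow> orbit_of H x \<inter> U \<noteq> {}"
    and d_le_1: "d x y \<le> 1"
    and extension: "\<epsilon> > 0 \<Longrightarrow> \<exists>\<delta>>0. \<forall>x\<in>U. \<forall>g\<in>H. \<forall>y\<in>U. g x = Some y \<longrightarrow>
       (\<exists>s\<in>S. dom s = mball x \<delta> \<and> germ_eq mtopology s g x \<and> ran s \<subseteq> mball y \<epsilon>)"
begin

lemmas H_lt = pseudogroupD(1)[OF H]
  and H_id = pseudogroupD(2)[OF H]
  and H_comp = pseudogroupD(3)[OF H]
  and H_inverse = pseudogroupD(4)[OF H]
  and S_H = germ_generatingD(1)[OF S]
  and S_id = germ_generatingD(2)[OF S]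
  and S_comp = germ_generatingD(3)[OF S]
  and S_inverse = germ_generatingD(4)[OF S]
  and S_restrict = germ_generatingD(5)[OF S]
  and S_germ = germ_generatingD(6)[OF S]

lemma S_lt: "s \<in> S \<Longrightarrow> local_transformation mtopology s"
  using H_lt S_H by blast

lemma S_in_M: "s \<in> S \<Longrightarrow> s x = Some y \<Longrightarrow> x \<in> M \<and> y \<in> M"
  using local_transformation_in_topspace[OF S_lt] by simp

lemma U_subset: "U \<subseteq> M"
  using openin_subset[OF U] by simp

lemma obtain_into_U:
  assumes "openin mtopology W" "z \<in> W"
  obtains k c where "k \<in> S" "dom k \<subseteq> W" "k z = Some c" "c \<in> U"
proof -
  have "z \<in> M" using assms openin_subset by fastforce
  then obtain h c where h: "h \<in> H" "h z = Some c" "c \<in> U"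
    using orbits unfolding orbit_of_def by blast
  then obtain V where V: "openin mtopology V" "z \<in> V" "h |` V \<in> S"
    using S_germ[OF h(1), of z] by blast
  show thesis
  proof
    show "(h |` V) |` W \<in> S" using S_restrict V assms by blast
    show "dom ((h |` V) |` W) \<subseteq> W" by auto
    show "((h |` V) |` W) z = Some c" using h V assms by (simp add: restrict_map_Some)
    show "c \<in> U" by fact
  qed
qed

text \<open>
  An extension of a germ is determined by the germ near the base point, uniformly in the germ: with
  \<open>k\<close> mapping \<open>z\<close> into \<open>U\<close>, \<open>s0\<close> extending the germ of \<open>s k\<inverse>\<close> and \<open>t\<close> that of \<open>k s'\<inverse>\<close>,
  quasi-effectiveness applied to \<open>s' k\<inverse> t\<close> and \<open>k\<inverse> t s0 k\<close> yields \<open>s' = s0 k\<close> near \<open>z\<close>.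
\<close>

lemma rigidity:
  assumes W: "openin mtopology W" "z \<in> W" and \<epsilon>: "\<epsilon> > 0"
  shows "\<exists>N. openin mtopology N \<and> z \<in> N \<and> N \<subseteq> W \<and>
    (\<forall>s\<in>S. \<forall>x\<in>N. \<forall>u\<in>U. W \<subseteq> dom s \<longrightarrow> s x = Some u \<longrightarrow>
       (\<forall>y\<in>N. d u (the (s y)) < \<epsilon>) \<and>
       (\<forall>s'\<in>S. W \<subseteq> dom s' \<longrightarrow> germ_eq mtopology s' s x \<longrightarrow> (\<forall>y\<in>N. s' y = s y)))"
proof -
  obtain k c where k: "k \<in> S" "dom k \<subseteq> W" "k z = Some c" "c \<in> U"
    using obtain_into_U[OF W] .
  let ?k' = "map_inverse k"
  note inv_k = map_inverse_Some_iff[OF S_lt[OF k(1)]]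
  have "openin mtopology (map_image k W \<inter> U)"
    using local_transformation_image[OF S_lt[OF k(1)] W(1)] U by (rule openin_Int)
  moreover have "c \<in> map_image k W \<inter> U" using k W by auto
  ultimately obtain r where r: "r > 0" "mball c r \<subseteq> map_image k W \<inter> U"
    unfolding openin_mtopology by blast
  have "r / 2 > 0" using r(1) by simp
  obtain \<delta>1 where \<delta>1: "\<delta>1 > 0" and ext1: "\<forall>x\<in>U. \<forall>g\<in>H. \<forall>y\<in>U. g x = Some y \<longrightarrow>
       (\<exists>s\<in>S. dom s = mball x \<delta>1 \<and> germ_eq mtopology s g x \<and> ran s \<subseteq> mball y (r/2))"
    using extension[OF \<open>r / 2 > 0\<close>] by (elim exE conjE) (rule that)
  have "min \<delta>1 \<epsilon> > 0" using \<delta>1 \<epsilon> by simp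
  obtain \<delta>2 where \<delta>2: "\<delta>2 > 0" and ext2: "\<forall>x\<in>U. \<forall>g\<in>H. \<forall>y\<in>U. g x = Some y \<longrightarrow>
       (\<exists>s\<in>S. dom s = mball x \<delta>2 \<and> germ_eq mtopology s g x \<and> ran s \<subseteq> mball y (min \<delta>1 \<epsilon>))"
    using extension[OF \<open>min \<delta>1 \<epsilon> > 0\<close>] by (elim exE conjE) (rule that)
  define B where "B = mball c (min (r/2) (\<delta>2/2))"
  define N where "N = map_preimage k B"
  have cM: "c \<in> M" using k(4) U_subset by blast
  have N: "openin mtopology N" "z \<in> N" "N \<subseteq> W"
  proof -
    show "openin mtopology N"
      unfolding N_def B_def using local_transformation_preimage[OF S_lt[OF k(1)]] by blast
    show "z \<in> N" using k(3) cM r(1) \<delta>2 by (simp add: N_def B_def)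
    have "N \<subseteq> dom k" by (auto simp: N_def)
    then show "N \<subseteq> W" using k(2) by blast
  qed
  have BU: "q \<in> U" if "q \<in> B" for q
  proof -
    have "q \<in> mball c r" using that mball_subset_concentric[of "min (r/2) (\<delta>2/2)" r c] r(1) by (auto simp: B_def)
    then show ?thesis using r(2) by blast
  qed
  have main: "(\<forall>y\<in>N. d u (the (s y)) < \<epsilon>) \<and>
       (\<forall>s'\<in>S. W \<subseteq> dom s' \<longrightarrow> germ_eq mtopology s' s x \<longrightarrow> (\<forall>y\<in>N. s' y = s y))"
    if s: "s \<in> S" "x \<in> N" "u \<in> U" "W \<subseteq> dom s" "s x = Some u" for s x u
  proof -
    obtain p where p: "k x = Some p" "p \<in> B" using s(2) by (auto simp: N_def)
    have xM: "x \<in> M" using S_in_M[OF s(1,5)] by simp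
    have "(s \<circ>\<^sub>m ?k') p = Some u" using p s(5) inv_k by simp
    moreover have "s \<circ>\<^sub>m ?k' \<in> H" using S_H S_comp S_inverse s(1) k(1) by blast
    ultimately obtain s0 where s0: "s0 \<in> S" "dom s0 = mball p \<delta>2"
      "germ_eq mtopology s0 (s \<circ>\<^sub>m ?k') p" "ran s0 \<subseteq> mball u (min \<delta>1 \<epsilon>)"
      using ext2[THEN bspec, OF BU[OF p(2)]] s(3) by blast
    have s0k: "germ_eq mtopology (s0 \<circ>\<^sub>m k) s x"
    proof (rule germ_eq_trans)
      show "germ_eq mtopology (s0 \<circ>\<^sub>m k) ((s \<circ>\<^sub>m ?k') \<circ>\<^sub>m k) x"
        using s0(3) germ_eq_refl[of x mtopology k] S_lt[OF k(1)] p(1) xM by (intro germ_eq_comp) auto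
      show "germ_eq mtopology ((s \<circ>\<^sub>m ?k') \<circ>\<^sub>m k) s x"
        by (rule germ_eq_comp_inverse_comp[OF S_lt[OF k(1)] p(1)])
    qed
    have val: "\<exists>v. s' y = Some v \<and> s0 (the (k y)) = Some v \<and> d u v < \<epsilon>"
      if s': "s' \<in> S" "W \<subseteq> dom s'" "germ_eq mtopology s' s x" and y: "y \<in> N" for s' y
    proof -
      let ?s = "map_inverse s'"
      note inv_s = map_inverse_Some_iff[OF S_lt[OF s'(1)]]
      have s'x: "s' x = Some u" using germ_eq_at[OF s'(3)] s(5) by simp
      have g: "(k \<circ>\<^sub>m ?s) u = Some p" using s'x p(1) inv_s by simp
      have gS: "k \<circ>\<^sub>m ?s \<in> S" using S_comp S_inverse s'(1) k(1) by blast
      then obtain t where t: "t \<in> S" "dom t = mball u \<delta>1"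
        "germ_eq mtopology t (k \<circ>\<^sub>m ?s) u" "ran t \<subseteq> mball p (r/2)"
        using ext1[THEN bspec, OF s(3)] g BU[OF p(2)] S_H by blast
      let ?P = "s' \<circ>\<^sub>m (?k' \<circ>\<^sub>m t)" and ?Q = "?k' \<circ>\<^sub>m (t \<circ>\<^sub>m (s0 \<circ>\<^sub>m k))"
      have PS: "?P \<in> S" and QS: "?Q \<in> S"
        using S_comp S_inverse s'(1) k(1) t(1) s0(1) by blast+
      have t_u: "t u = Some p" using germ_eq_at[OF t(3)] g by simp
      have P_germ: "germ_eq mtopology ?P Some u"
      proof (rule germ_eq_trans)
        have pM: "p \<in> M" and k'p: "?k' p = Some x"
          using S_in_M[OF k(1) p(1)] p(1) inv_k by auto
        have k't: "germ_eq mtopology (?k' \<circ>\<^sub>m t) (?k' \<circ>\<^sub>m (k \<circ>\<^sub>m ?s)) u"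
          using germ_eq_comp[OF germ_eq_refl t(3) S_lt[OF t(1)] t_u] pM by simp
        have "(?k' \<circ>\<^sub>m t) u = Some x" "x \<in> topspace mtopology" using t_u k'p xM by auto
        then show "germ_eq mtopology ?P (s' \<circ>\<^sub>m (?k' \<circ>\<^sub>m (k \<circ>\<^sub>m ?s))) u"
          using germ_eq_comp[OF germ_eq_refl k't S_lt[OF S_comp[OF S_inverse[OF k(1)] t(1)]]] by blast
        show "germ_eq mtopology (s' \<circ>\<^sub>m (?k' \<circ>\<^sub>m (k \<circ>\<^sub>m ?s))) Some u"
          unfolding germ_eq_def
        proof (intro exI[of _ "dom (k \<circ>\<^sub>m ?s)"] conjI ballI)
          show "openin mtopology (dom (k \<circ>\<^sub>m ?s))"
            using local_transformation_open_dom[OF S_lt[OF gS]] .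
          show "u \<in> dom (k \<circ>\<^sub>m ?s)" using g by blast
          fix v assume "v \<in> dom (k \<circ>\<^sub>m ?s)"
          then obtain w q where "?s v = Some w" "k w = Some q" by (auto simp: map_comp_Some)
          moreover from this have "?k' q = Some w" "s' w = Some v" using inv_k inv_s by auto
          ultimately show "(s' \<circ>\<^sub>m (?k' \<circ>\<^sub>m (k \<circ>\<^sub>m ?s))) v = Some v" by simp
        qed
      qed
      have s0k': "germ_eq mtopology (s0 \<circ>\<^sub>m k) s' x"
        using germ_eq_trans[OF s0k germ_eq_sym[OF s'(3)]] .
      have s0k_x: "(s0 \<circ>\<^sub>m k) x = Some u" using germ_eq_at[OF s0k] s(5) by simp
      have s0kS: "s0 \<circ>\<^sub>m k \<in> S" using S_comp s0(1) k(1) by blast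
      have tk: "germ_eq mtopology (t \<circ>\<^sub>m (s0 \<circ>\<^sub>m k)) k x"
        using germ_eq_trans[OF germ_eq_comp[OF t(3) s0k' S_lt[OF s0kS] s0k_x]
            germ_eq_comp_inverse_comp[OF S_lt[OF s'(1)] s'x]] .
      have tS: "t \<circ>\<^sub>m (s0 \<circ>\<^sub>m k) \<in> S" using S_comp t(1) s0kS by blast
      have tk_x: "(t \<circ>\<^sub>m (s0 \<circ>\<^sub>m k)) x = Some p" using germ_eq_at[OF tk] p(1) by simp
      have "p \<in> topspace mtopology" using S_in_M[OF k(1) p(1)] by simp
      then have Q_germ: "germ_eq mtopology ?Q Some x"
        using germ_eq_trans[OF germ_eq_comp[OF germ_eq_refl tk S_lt[OF tS] tk_x]
            germ_eq_inverse_comp[OF S_lt[OF k(1)] p(1)]] by blast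
      obtain q where q: "k y = Some q" "q \<in> B" using y by (auto simp: N_def)
      have "d p q < \<delta>2" using triangle''[of p c q] p(2) q(2) by (simp add: B_def)
      then have "q \<in> dom s0" using s0(2) p(2) q(2) by (simp add: B_def)
      then obtain v where v: "s0 q = Some v" by blast
      then have v_ball: "v \<in> mball u (min \<delta>1 \<epsilon>)" using s0(4) by (auto intro: ranI)
      then have "v \<in> dom t" using t(2) by simp
      then obtain a where a: "t v = Some a" by blast
      then have "a \<in> mball p (r/2)" using t(4) by (auto intro: ranI)
      then have "a \<in> mball c r" using triangle[of c p a] p(2) by (simp add: B_def)
      then have "a \<in> map_image k W" using r(2) by blast
      then obtain y' where y': "y' \<in> W" "k y' = Some a" by auto
      obtain v' where v': "s' y' = Some v'" using y'(1) s'(2) by blast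
      have k'a: "?k' a = Some y'" using y' inv_k by simp
      have "?P v = Some v'" using a k'a v' by simp
      then have "v' = v" by (rule identity_rigid_germ[OF rigid PS P_germ])
      have "?Q y = Some y'" using q v a k'a by simp
      then have "y' = y" by (rule identity_rigid_germ[OF rigid QS Q_germ])
      show ?thesis using v' \<open>v' = v\<close> \<open>y' = y\<close> v q(1) v_ball by simp
    qed
    show ?thesis
    proof (intro conjI ballI impI)
      fix y assume y: "y \<in> N"
      show "d u (the (s y)) < \<epsilon>"
        using val[OF s(1,4) germ_eq_refl y] xM by auto
      fix s' assume "s' \<in> S" "W \<subseteq> dom s'" "germ_eq mtopology s' s x"
      then show "s' y = s y"
        using val[OF _ _ _ y] val[OF s(1,4) germ_eq_refl y] xM by fastforce
    qed
  qed
  show ?thesis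
    using N main by (intro exI[of _ N]) blast
qed

text \<open>
  \<open>rho\<close> is the metric obtained from \<open>d\<close> by collapsing the complement of \<open>U\<close> to a point. Hence a germ
  contributes to the supremum defining \<open>D\<close> only if it maps into \<open>U\<close>, where germs can be extended.
  The \<open>1\<close> in the infimum covers the case \<open>U = M\<close>.
\<close>

definition height :: "'a \<Rightarrow> real" where
  "height x = Inf (insert 1 (d x ` (M - U)))"

definition rho :: "'a \<Rightarrow> 'a \<Rightarrow> real" where
  "rho x y = min (d x y) (height x + height y)"

definition D :: "'a set \<Rightarrow> 'a \<Rightarrow> 'a \<Rightarrow> real" where
  "D W x y = (SUP s\<in>{s\<in>S. dom s = W}. rho (the (s x)) (the (s y)))"

definition good :: "'a set \<Rightarrow> bool" where
  "good W \<longleftrightarrow> openin mtopology W \<and>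
     (\<forall>x\<in>W. \<forall>g\<in>H. \<forall>y\<in>U. g x = Some y \<longrightarrow> (\<exists>s\<in>S. dom s = W \<and> germ_eq mtopology s g x))"

lemma height_bdd: "bdd_below (insert 1 (d x ` (M - U)))"
  by (rule bdd_belowI[of _ 0]) auto

lemma height_nonneg: "0 \<le> height x"
  unfolding height_def by (rule cInf_greatest) auto

lemma height_outside: "x \<in> M \<Longrightarrow> x \<notin> U \<Longrightarrow> height x = 0"
proof -
  assume "x \<in> M" "x \<notin> U"
  then have "d x x \<in> insert 1 (d x ` (M - U))" by blast
  then have "height x \<le> d x x"
    unfolding height_def by (rule cInf_lower[OF _ height_bdd])
  then show "height x = 0" using \<open>x \<in> M\<close> height_nonneg[of x] by simp
qed

lemma height_pos:
  assumes "x \<in> U"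
  shows "height x > 0"
proof -
  obtain r where r: "r > 0" "mball x r \<subseteq> U"
    using U assms unfolding openin_mtopology by blast
  have "min r 1 \<le> height x"
    unfolding height_def
  proof (rule cInf_greatest)
    fix a assume "a \<in> insert 1 (d x ` (M - U))"
    then consider "a = 1" | y where "y \<in> M" "y \<notin> U" "a = d x y" by blast
    then show "min r 1 \<le> a"
    proof cases
      case (2 y)
      then have "y \<notin> mball x r" using r by blast
      then show ?thesis using 2 assms U_subset by auto
    qed simp
  qed simp
  then show ?thesis using r by simp
qed

lemma height_Lipschitz:
  assumes "x \<in> M" "y \<in> M"
  shows "height x \<le> d x y + height y"
proof -
  have "height x - d x y \<le> height y"
    unfolding height_def[of y]
  proof (rule cInf_greatest)
    fix a assume "a \<in> insert 1 (d y ` (M - U))"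
    then consider "a = 1" | z where "z \<in> M" "z \<notin> U" "a = d y z" by blast
    then show "height x - d x y \<le> a"
    proof cases
      case 1
      have "height x \<le> 1" unfolding height_def by (rule cInf_lower[OF _ height_bdd]) simp
      then show ?thesis using 1 nonneg[of x y] by linarith
    next
      case (2 z)
      have "height x \<le> d x z"
        unfolding height_def by (rule cInf_lower[OF _ height_bdd]) (use 2 in blast)
      then show ?thesis using triangle[of x y z] assms 2 by linarith
    qed
  qed simp
  then show ?thesis by linarith
qed

lemma rho_nonneg: "0 \<le> rho x y"
  using height_nonneg by (simp add: rho_def)

lemma rho_commute: "rho x y = rho y x"
  by (simp add: rho_def commute add.commute)

lemma rho_le_d: "rho x y \<le> d x y"
  by (simp add: rho_def)

lemma rho_le_1: "rho x y \<le> 1"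
  using rho_le_d d_le_1 order_trans by blast

lemma rho_triangle:
  assumes "x \<in> M" "y \<in> M" "z \<in> M"
  shows "rho x z \<le> rho x y + rho y z"
  using triangle[OF assms] height_Lipschitz[OF assms(1,2)] height_Lipschitz[OF assms(3,2)]
    height_nonneg[of y] commute[of y z]
  unfolding rho_def by linarith

lemma rho_outside: "x \<in> M \<Longrightarrow> y \<in> M \<Longrightarrow> x \<notin> U \<Longrightarrow> y \<notin> U \<Longrightarrow> rho x y = 0"
  by (simp add: rho_def height_outside)

lemma rho_less_imp_d_less:
  assumes "rho u v < min r (height u)"
  shows "d u v < r"
  using assms height_nonneg[of v] unfolding rho_def by linarith

lemma rho_le_D:
  assumes "s \<in> S" "dom s = W"
  shows "rho (the (s x)) (the (s y)) \<le> D W x y"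
  unfolding D_def
proof (rule cSUP_upper)
  show "s \<in> {s \<in> S. dom s = W}" using assms by simp
  show "bdd_above ((\<lambda>s. rho (the (s x)) (the (s y))) ` {s \<in> S. dom s = W})"
    by (rule bdd_aboveI[of _ 1]) (use rho_le_1 in auto)
qed

lemma D_le:
  assumes "openin mtopology W"
    and "\<And>s. s \<in> S \<Longrightarrow> dom s = W \<Longrightarrow> rho (the (s x)) (the (s y)) \<le> c"
  shows "D W x y \<le> c"
  unfolding D_def
proof (rule cSUP_least)
  have "(Some |` M) |` W \<in> S" using S_restrict[OF S_id assms(1)] by simp
  moreover have "dom ((Some |` M) |` W) = W"
    using openin_subset[OF assms(1)] by auto
  ultimately show "{s \<in> S. dom s = W} \<noteq> {}" by blast
qed (use assms(2) in simp)

lemma D_nonneg: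
  assumes "openin mtopology W"
  shows "0 \<le> D W x y"
proof -
  have "(Some |` M) |` W \<in> S" using S_restrict[OF S_id assms(1)] by simp
  moreover have "dom ((Some |` M) |` W) = W"
    using openin_subset[OF assms(1)] by auto
  ultimately show ?thesis using rho_le_D rho_nonneg order_trans by blast
qed

lemma D_commute: "D W x y = D W y x"
  unfolding D_def by (subst rho_commute) (rule refl)

lemma goodD:
  assumes "good W"
  shows "openin mtopology W"
    and "x \<in> W \<Longrightarrow> g \<in> H \<Longrightarrow> g x = Some y \<Longrightarrow> y \<in> U \<Longrightarrow> \<exists>s\<in>S. dom s = W \<and> germ_eq mtopology s g x"
  using assms unfolding good_def by blast+

lemma good_subset: "good W \<Longrightarrow> W \<subseteq> M"
  using goodD(1) openin_subset by fastforce

lemma good_obtain_into_U: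
  assumes "good W" "x \<in> W"
  obtains s u where "s \<in> S" "dom s = W" "s x = Some u" "u \<in> U"
proof -
  obtain k c where k: "k \<in> S" "k x = Some c" "c \<in> U"
    using obtain_into_U[OF goodD(1)[OF assms(1)] assms(2)] .
  then obtain s where "s \<in> S" "dom s = W" "germ_eq mtopology s k x"
    using goodD(2)[OF assms S_H] by blast
  then show thesis using that k germ_eq_at by metis
qed

lemma good_exists:
  assumes "z \<in> M"
  shows "\<exists>W. good W \<and> z \<in> W"
proof -
  obtain k c where k: "k \<in> S" "k z = Some c" "c \<in> U"
    using obtain_into_U[of M z] assms by blast
  note inv_k = map_inverse_Some_iff[OF S_lt[OF k(1)]]
  obtain \<delta> where \<delta>: "\<delta> > 0" and ext: "\<forall>x\<in>U. \<forall>g\<in>H. \<forall>y\<in>U. g x = Some y \<longrightarrow>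
       (\<exists>s\<in>S. dom s = mball x \<delta> \<and> germ_eq mtopology s g x \<and> ran s \<subseteq> mball y 1)"
    using extension[OF zero_less_one] by (elim exE conjE) (rule that)
  define W where "W = map_preimage k (mball c (\<delta>/2) \<inter> U)"
  have W: "openin mtopology W"
    unfolding W_def using local_transformation_preimage[OF S_lt[OF k(1)] openin_Int[OF openin_mball U]] .
  have "z \<in> W" using k \<delta> U_subset by (auto simp: W_def)
  moreover have "\<exists>s\<in>S. dom s = W \<and> germ_eq mtopology s g x"
    if x: "x \<in> W" and g: "g \<in> H" "y \<in> U" "g x = Some y" for x g y
  proof -
    obtain p where p: "k x = Some p" "p \<in> mball c (\<delta>/2)" "p \<in> U" using x by (auto simp: W_def)
    have xM: "x \<in> topspace mtopology" using S_in_M[OF k(1) p(1)] by simp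
    have "g \<circ>\<^sub>m map_inverse k \<in> H" using H_comp S_H S_inverse g k(1) by blast
    moreover have "(g \<circ>\<^sub>m map_inverse k) p = Some y" using p(1) inv_k g(3) by simp
    ultimately obtain s0 where s0: "s0 \<in> S" "dom s0 = mball p \<delta>"
        "germ_eq mtopology s0 (g \<circ>\<^sub>m map_inverse k) p"
      using ext[THEN bspec, OF p(3)] g(2) by blast
    have "W \<subseteq> dom (s0 \<circ>\<^sub>m k)"
    proof
      fix v assume "v \<in> W"
      then obtain q where q: "k v = Some q" "q \<in> mball c (\<delta>/2)" by (auto simp: W_def)
      then have "q \<in> mball p \<delta>" using p(2) triangle''[of p c q] by simp
      then have "q \<in> dom s0" unfolding s0(2) .
      then show "v \<in> dom (s0 \<circ>\<^sub>m k)" using q(1) by (auto simp: map_comp_Some)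
    qed
    then have "dom ((s0 \<circ>\<^sub>m k) |` W) = W" by auto
    moreover have "(s0 \<circ>\<^sub>m k) |` W \<in> S" using S_restrict[OF S_comp[OF s0(1) k(1)] W] .
    moreover have "germ_eq mtopology ((s0 \<circ>\<^sub>m k) |` W) g x"
      using germ_eq_trans[OF germ_eq_restrict[OF W x]
          germ_eq_trans[OF germ_eq_comp[OF s0(3) germ_eq_refl[OF xM] S_lt[OF k(1)] p(1)]
            germ_eq_comp_inverse_comp[OF S_lt[OF k(1)] p(1)]]] .
    ultimately show ?thesis by blast
  qed
  ultimately have "good W \<and> z \<in> W"
    unfolding good_def using W by blast
  then show ?thesis ..
qed

lemma D_invariant_le:
  assumes h: "h \<in> H" "h z = Some z'" and W: "good W" "z \<in> W" and W': "good W'" "z' \<in> W'"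
  shows "\<exists>N. openin mtopology N \<and> z \<in> N \<and> N \<subseteq> W \<and> N \<subseteq> map_preimage h W' \<and>
    (\<forall>x\<in>N. \<forall>y\<in>N. D W x y \<le> D W' (the (h x)) (the (h y)))"
proof -
  obtain V where V: "openin mtopology V" "z \<in> V" "h |` V \<in> S"
    using S_germ[OF h(1), of z] h(2) by blast
  define W0 where "W0 = W \<inter> V \<inter> map_preimage h W'"
  have W0: "openin mtopology W0" "z \<in> W0"
    unfolding W0_def using V W W' h
      openin_Int[OF openin_Int[OF goodD(1)[OF W(1)] V(1)] local_transformation_preimage[OF H_lt[OF h(1)] goodD(1)[OF W'(1)]]]
    by auto
  obtain N where N: "openin mtopology N" "z \<in> N" "N \<subseteq> W0" and rig: "\<forall>s\<in>S. \<forall>x\<in>N. \<forall>u\<in>U. W0 \<subseteq> dom s \<longrightarrow> s x = Some u \<longrightarrow>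
       (\<forall>y\<in>N. d u (the (s y)) < 1) \<and>
       (\<forall>s'\<in>S. W0 \<subseteq> dom s' \<longrightarrow> germ_eq mtopology s' s x \<longrightarrow> (\<forall>y\<in>N. s' y = s y))"
    using rigidity[OF W0 zero_less_one] by (elim exE conjE) (rule that)
  have transfer: "rho (the (s x)) (the (s y)) \<le> D W' (the (h x)) (the (h y))"
    if s: "s \<in> S" "dom s = W" and x: "x \<in> N" and y: "y \<in> N" and u: "s x = Some u" "u \<in> U" for s x y u
  proof -
    obtain x' y' where x': "h x = Some x'" "x' \<in> W'" "x \<in> V" and y': "h y = Some y'" "y \<in> V"
      using subsetD[OF N(3) x] subsetD[OF N(3) y] unfolding W0_def Int_iff in_map_preimage_iff by blast
    have xM: "x \<in> topspace mtopology" using S_in_M[OF s(1) u(1)] by simp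
    let ?g = "s \<circ>\<^sub>m map_inverse h"
    have "?g x' = Some u" using u(1) x'(1) by (simp add: map_inverse_Some_iff[OF H_lt[OF h(1)]])
    moreover have "?g \<in> H" using H_comp H_inverse S_H s(1) h(1) by blast
    ultimately obtain s' where s': "s' \<in> S" "dom s' = W'" "germ_eq mtopology s' ?g x'"
      using goodD(2)[OF W'(1) x'(2)] u(2) by blast
    have hx: "(h |` V) x = Some x'" using x' by (simp add: restrict_map_Some)
    have "s' \<circ>\<^sub>m (h |` V) \<in> S" using S_comp s'(1) V(3) by blast
    moreover have "W0 \<subseteq> dom (s' \<circ>\<^sub>m (h |` V))"
    proof
      fix v assume "v \<in> W0"
      then obtain w where "v \<in> V" "h v = Some w" "w \<in> dom s'" using s'(2) by (auto simp: W0_def)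
      then show "v \<in> dom (s' \<circ>\<^sub>m (h |` V))" by (auto simp: map_comp_Some restrict_map_Some)
    qed
    moreover have "germ_eq mtopology (s' \<circ>\<^sub>m (h |` V)) s x"
      using germ_eq_trans[OF germ_eq_comp[OF s'(3) germ_eq_restrict[OF V(1) x'(3)] S_lt[OF V(3)] hx]
        germ_eq_comp_inverse_comp[OF H_lt[OF h(1)] x'(1)]] .
    moreover have "W0 \<subseteq> dom s" using s(2) by (auto simp: W0_def)
    ultimately have eq: "(s' \<circ>\<^sub>m (h |` V)) v = s v" if "v \<in> N" for v
      using rig s(1) x u that by blast
    have "s' x' = s x" "s' y' = s y"
      using eq[OF x] eq[OF y] x' y' by (auto simp: restrict_map_def)
    then show ?thesis
      using rho_le_D[OF s'(1,2), of x' y'] x'(1) y'(1) by simp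
  qed
  have "D W x y \<le> D W' (the (h x)) (the (h y))" if x: "x \<in> N" and y: "y \<in> N" for x y
  proof (rule D_le[OF goodD(1)[OF W(1)]])
    fix s assume s: "s \<in> S" "dom s = W"
    have "x \<in> dom s" "y \<in> dom s" using x y N(3) s(2) unfolding W0_def by blast+
    then obtain u v where u: "s x = Some u" and v: "s y = Some v" by blast
    consider "u \<in> U" | "v \<in> U" | "u \<notin> U" "v \<notin> U" by blast
    then show "rho (the (s x)) (the (s y)) \<le> D W' (the (h x)) (the (h y))"
    proof cases
      case 1
      then show ?thesis using transfer[OF s x y u] by blast
    next
      case 2
      then show ?thesis using transfer[OF s y x v] rho_commute D_commute by metis
    next
      case 3
      then show ?thesis
        using u v S_in_M[OF s(1)] rho_outside D_nonneg[OF goodD(1)[OF W'(1)]] by simp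
    qed
  qed
  moreover have "N \<subseteq> W" "N \<subseteq> map_preimage h W'" using N(3) by (auto simp: W0_def)
  ultimately show ?thesis using N(1,2) by blast
qed

lemma D_invariant:
  assumes h: "h \<in> H" "h z = Some z'" and W: "good W" "z \<in> W" and W': "good W'" "z' \<in> W'"
  shows "\<exists>N. openin mtopology N \<and> z \<in> N \<and> N \<subseteq> W \<and> N \<subseteq> map_preimage h W' \<and>
    (\<forall>x\<in>N. \<forall>y\<in>N. D W x y = D W' (the (h x)) (the (h y)))"
proof -
  note inv_h = map_inverse_Some_iff[OF H_lt[OF h(1)]]
  obtain N where N: "openin mtopology N" "z \<in> N" "N \<subseteq> W" "N \<subseteq> map_preimage h W'"
    "\<forall>x\<in>N. \<forall>y\<in>N. D W x y \<le> D W' (the (h x)) (the (h y))"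
    using D_invariant_le[OF assms] by blast
  have "map_inverse h z' = Some z" using h(2) inv_h by simp
  then obtain N' where N': "openin mtopology N'" "z' \<in> N'"
    "\<forall>x\<in>N'. \<forall>y\<in>N'. D W' x y \<le> D W (the (map_inverse h x)) (the (map_inverse h y))"
    using D_invariant_le[OF H_inverse[OF h(1)] _ W' W] by blast
  have "D W x y = D W' (the (h x)) (the (h y))"
    if "x \<in> N \<inter> map_preimage h N'" "y \<in> N \<inter> map_preimage h N'" for x y
  proof (rule antisym)
    show "D W x y \<le> D W' (the (h x)) (the (h y))" using N(5) that by blast
    from that obtain x' y' where "h x = Some x'" "x' \<in> N'" "h y = Some y'" "y' \<in> N'" by auto
    moreover from this have "map_inverse h x' = Some x" "map_inverse h y' = Some y" using inv_h by auto
    ultimately show "D W' (the (h x)) (the (h y)) \<le> D W x y" using N'(3) by fastforce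
  qed
  moreover have "openin mtopology (N \<inter> map_preimage h N')"
    using N(1) local_transformation_preimage[OF H_lt[OF h(1)] N'(1)] by (rule openin_Int)
  moreover have "z \<in> N \<inter> map_preimage h N'" using N(2) N'(2) h(2) by auto
  ultimately show ?thesis
    using N(3,4) by (intro exI[of _ "N \<inter> map_preimage h N'"]) blast
qed

lemma D_Metric_space:
  assumes "good W"
  shows "Metric_space W (D W)"
proof
  note W = goodD(1)[OF assms]
  show "0 \<le> D W x y" for x y using D_nonneg[OF W] .
  show "D W x y = D W y x" for x y by (rule D_commute)
  show "D W x y = 0 \<longleftrightarrow> x = y" if xy: "x \<in> W" "y \<in> W" for x y
  proof
    assume 0: "D W x y = 0"
    obtain s u where s: "s \<in> S" "dom s = W" "s x = Some u" "u \<in> U"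
      using good_obtain_into_U[OF assms xy(1)] .
    obtain v where v: "s y = Some v" using s(2) xy(2) by blast
    have uv: "u \<in> M" "v \<in> M" using S_in_M[OF s(1)] s(3) v by auto
    have "rho u v \<le> 0" using rho_le_D[OF s(1,2), of x y] 0 s(3) v by simp
    then have "d u v < r" if "r > 0" for r
      using rho_less_imp_d_less[of u v r] height_pos[OF s(4)] that by simp
    then have "u = v" using uv mdist_pos_eq by blast
    then show "x = y" using local_transformation_inj[OF S_lt[OF s(1)]] s(3) v by blast
  next
    assume "x = y"
    have "D W x x \<le> 0"
    proof (rule D_le[OF W])
      fix s assume s: "s \<in> S" "dom s = W"
      then obtain u where "s x = Some u" using xy(1) by blast
      then show "rho (the (s x)) (the (s x)) \<le> 0"
        using rho_le_d[of u u] S_in_M[OF s(1)] by simp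
    qed
    then show "D W x y = 0" using D_nonneg[OF W, of x y] \<open>x = y\<close> by simp
  qed
  show "D W x z \<le> D W x y + D W y z" if xyz: "x \<in> W" "y \<in> W" "z \<in> W" for x y z
  proof (rule D_le[OF W])
    fix s assume s: "s \<in> S" "dom s = W"
    then obtain a b c where abc: "s x = Some a" "s y = Some b" "s z = Some c"
      using xyz by blast
    have "rho a c \<le> rho a b + rho b c"
      using rho_triangle S_in_M[OF s(1)] abc by blast
    then show "rho (the (s x)) (the (s z)) \<le> D W x y + D W y z"
      using rho_le_D[OF s, of x y] rho_le_D[OF s, of y z] abc by simp
  qed
qed

lemma D_near:
  assumes W: "good W" "z \<in> W" and \<epsilon>: "\<epsilon> > 0"
  shows "\<exists>N. openin mtopology N \<and> z \<in> N \<and> (\<forall>y\<in>N. D W z y < \<epsilon>)"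
proof -
  have "\<epsilon> / 2 > 0" using \<epsilon> by simp
  obtain N where N: "openin mtopology N" "z \<in> N" "N \<subseteq> W" and rig: "\<forall>s\<in>S. \<forall>x\<in>N. \<forall>u\<in>U. W \<subseteq> dom s \<longrightarrow> s x = Some u \<longrightarrow>
       (\<forall>y\<in>N. d u (the (s y)) < \<epsilon>/2) \<and>
       (\<forall>s'\<in>S. W \<subseteq> dom s' \<longrightarrow> germ_eq mtopology s' s x \<longrightarrow> (\<forall>y\<in>N. s' y = s y))"
    using rigidity[OF goodD(1)[OF W(1)] W(2) \<open>\<epsilon> / 2 > 0\<close>] by (elim exE conjE) (rule that)
  have close: "d u v < \<epsilon>/2" if "s \<in> S" "dom s = W" "x \<in> N" "y \<in> N" "s x = Some u" "u \<in> U" "s y = Some v" for s x y u v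
  proof -
    have "W \<subseteq> dom s" using that(2) by simp
    then have "d u (the (s y)) < \<epsilon>/2"
      using rig[THEN bspec, OF that(1), THEN bspec, OF that(3), THEN bspec, OF that(6), THEN mp, THEN mp,
          OF _ that(5), THEN conjunct1, THEN bspec, OF _ that(4)] by blast
    then show ?thesis using that(7) by simp
  qed
  have "D W z y \<le> \<epsilon>/2" if y: "y \<in> N" for y
  proof (rule D_le[OF goodD(1)[OF W(1)]])
    fix s assume s: "s \<in> S" "dom s = W"
    then obtain u v where u: "s z = Some u" and v: "s y = Some v"
      using y W(2) N(3) by blast
    consider "u \<in> U" | "v \<in> U" | "u \<notin> U" "v \<notin> U" by blast
    then have "rho u v \<le> \<epsilon>/2"
    proof cases
      case 1
      then show ?thesis using close[OF s N(2) y u _ v] rho_le_d[of u v] by simp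
    next
      case 2
      then show ?thesis using close[OF s y N(2) v _ u] rho_le_d[of v u] rho_commute[of u v] by simp
    next
      case 3
      then show ?thesis using rho_outside S_in_M[OF s(1)] u v \<epsilon> by simp
    qed
    then show "rho (the (s z)) (the (s y)) \<le> \<epsilon>/2" using u v by simp
  qed
  then have "\<forall>y\<in>N. D W z y < \<epsilon>" using \<epsilon> by (smt (verit) field_sum_of_halves)
  then show ?thesis using N(1,2) by blast
qed

lemma D_far:
  assumes W: "good W" "z \<in> W" and V: "openin mtopology V" "z \<in> V"
  shows "\<exists>a>0. \<forall>y\<in>W. D W z y < a \<longrightarrow> y \<in> V"
proof -
  obtain s u where s: "s \<in> S" "dom s = W" "s z = Some u" "u \<in> U"
    using good_obtain_into_U[OF W] .
  have "openin mtopology (map_image s V)" "u \<in> map_image s V"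
    using local_transformation_image[OF S_lt[OF s(1)] V(1)] s(3) V(2) by auto
  then obtain r where r: "r > 0" "mball u r \<subseteq> map_image s V"
    unfolding openin_mtopology by blast
  have "y \<in> V" if y: "y \<in> W" "D W z y < min r (height u)" for y
  proof -
    obtain v where v: "s y = Some v" using y(1) s(2) by blast
    have "rho u v < min r (height u)"
      using rho_le_D[OF s(1,2), of z y] y(2) s(3) v by simp
    then have "d u v < r" by (rule rho_less_imp_d_less)
    then have "v \<in> mball u r" using S_in_M[OF s(1)] s(3) v by simp
    then have "v \<in> map_image s V" using r(2) by blast
    then show "y \<in> V" using local_transformation_inj[OF S_lt[OF s(1)]] v by (metis in_map_image_iff)
  qed
  then show ?thesis
    using r(1) height_pos[OF s(4)] by (intro exI[of _ "min r (height u)"]) simp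
qed

definition invariant_metrics :: "'a metric set" where
  "invariant_metrics = {metric (W, D W) | W. good W}"

lemma mspace_D [simp]: "good W \<Longrightarrow> mspace (metric (W, D W)) = W"
  and mdist_D [simp]: "good W \<Longrightarrow> mdist (metric (W, D W)) = D W"
  using Metric_space.mspace_metric[OF D_Metric_space] Metric_space.mdist_metric[OF D_Metric_space]
  by auto

lemma openin_D_iff:
  assumes W: "good W"
  shows "openin (mtopology_of (metric (W, D W))) V \<longleftrightarrow> openin mtopology V \<and> V \<subseteq> W"
proof
  assume "openin (mtopology_of (metric (W, D W))) V"
  then have V: "V \<subseteq> W" "\<forall>x\<in>V. \<exists>r>0. \<forall>y\<in>W. D W x y < r \<longrightarrow> y \<in> V"
    using W by (simp_all add: openin_mtopology_of)
  have "\<exists>N. openin mtopology N \<and> x \<in> N \<and> N \<subseteq> V" if x: "x \<in> V" for x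
  proof -
    obtain r where r: "r > 0" "\<forall>y\<in>W. D W x y < r \<longrightarrow> y \<in> V" using V(2) x by blast
    obtain N where N: "openin mtopology N" "x \<in> N" "\<forall>y\<in>N. D W x y < r"
      using D_near[OF W _ r(1)] V(1) x by blast
    have "openin mtopology (N \<inter> W)" using N(1) goodD(1)[OF W] by (rule openin_Int)
    then show ?thesis using N r V(1) x by (intro exI[of _ "N \<inter> W"]) blast
  qed
  then have "openin mtopology V" using openin_subopen[of mtopology V] by blast
  then show "openin mtopology V \<and> V \<subseteq> W" using V(1) by simp
next
  assume V: "openin mtopology V \<and> V \<subseteq> W"
  then show "openin (mtopology_of (metric (W, D W))) V"
    using W D_far[OF W] by (simp add: openin_mtopology_of subset_iff)
qed

lemma locally_equal_cover_invariant_metrics: "locally_equal_cover M invariant_metrics"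
  unfolding locally_equal_cover_def
proof (intro conjI ballI impI)
  have "(\<Union>m\<in>invariant_metrics. mspace m) = \<Union>{W. good W}"
    unfolding invariant_metrics_def using mspace_D by blast
  also have "\<dots> = M"
    using good_exists good_subset by blast
  finally show "M = (\<Union>m\<in>invariant_metrics. mspace m)" ..
next
  fix m m' assume "m \<in> invariant_metrics" "m' \<in> invariant_metrics"
  then obtain W W' where m: "m = metric (W, D W)" "good W" and m': "m' = metric (W', D W')" "good W'"
    unfolding invariant_metrics_def by blast
  let ?X = "mspace m \<inter> mspace m'"
  have X: "?X = W \<inter> W'" using m m' by simp
  have oX: "openin mtopology (W \<inter> W')" using goodD(1) m(2) m'(2) by blast
  show X1: "openin (mtopology_of m) ?X" and X2: "openin (mtopology_of m') ?X"
    unfolding X using m m' oX by (auto simp: openin_D_iff)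
  show "metrics_locally_equal (submetric m ?X) (submetric m' ?X)"
    unfolding metrics_locally_equal_def
  proof (intro conjI ballI)
    show "mspace (submetric m ?X) = mspace (submetric m' ?X)" by auto
    have iff: "openin (mtopology_of (submetric m ?X)) V \<longleftrightarrow> openin mtopology V \<and> V \<subseteq> W \<inter> W'"
      "openin (mtopology_of (submetric m' ?X)) V \<longleftrightarrow> openin mtopology V \<and> V \<subseteq> W \<inter> W'" for V
      using openin_open_subtopology[OF X1] openin_open_subtopology[OF X2]
        openin_D_iff[OF m(2)] openin_D_iff[OF m'(2)] m m' X
      by (auto simp: mtopology_of_submetric)
    then show "mtopology_of (submetric m ?X) = mtopology_of (submetric m' ?X)"
      by (simp add: topology_eq)
    fix z assume "z \<in> mspace (submetric m ?X)"
    then have z: "z \<in> W" "z \<in> W'" using X by auto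
    then have "(Some |` M) z = Some z" using good_subset[OF m(2)] by (auto simp: restrict_map_Some)
    then obtain N where N: "openin mtopology N" "z \<in> N" "N \<subseteq> W" "N \<subseteq> map_preimage (Some |` M) W'"
      "\<forall>x\<in>N. \<forall>y\<in>N. D W x y = D W' (the ((Some |` M) x)) (the ((Some |` M) y))"
      using D_invariant[OF _ _ m(2) z(1) m'(2) z(2), of "Some |` M"] H_id by auto
    have N': "x \<in> W' \<and> (Some |` M) x = Some x" if x: "x \<in> N" for x
    proof -
      obtain w where "w \<in> W'" "(Some |` M) x = Some w"
        using subsetD[OF N(4) x] unfolding in_map_preimage_iff by blast
      then show ?thesis by (auto simp: restrict_map_Some)
    qed
    have "openin (mtopology_of (submetric m ?X)) N"
      unfolding iff using N(1,3) N' by blast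
    moreover have "\<forall>x\<in>N. \<forall>y\<in>N. mdist (submetric m ?X) x y = mdist (submetric m' ?X) x y"
      using N(5) N' m m' by simp
    ultimately show "\<exists>V. openin (mtopology_of (submetric m ?X)) V \<and> z \<in> V \<and>
        (\<forall>x\<in>V. \<forall>y\<in>V. mdist (submetric m ?X) x y = mdist (submetric m' ?X) x y)"
      using N(2) by blast
  qed
qed

lemma local_isometry_invariant_metrics:
  assumes "invariant_metrics \<in> Q" and h: "h \<in> H"
  shows "local_isometry mtopology Q h"
  unfolding local_isometry_def
proof (intro conjI bexI[OF _ assms(1)] ballI)
  show "local_transformation mtopology h" using H_lt[OF h] .
  fix m m' z assume "m \<in> invariant_metrics" "m' \<in> invariant_metrics"
  then obtain W W' where m: "m = metric (W, D W)" "good W" and m': "m' = metric (W', D W')" "good W'"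
    unfolding invariant_metrics_def by blast
  let ?A = "mspace m \<inter> map_preimage h (mspace m' \<inter> ran h)"
  assume "z \<in> ?A"
  then obtain z' where z: "z \<in> W" "h z = Some z'" "z' \<in> W'" using m m' by auto
  obtain N where N: "openin mtopology N" "z \<in> N" "N \<subseteq> W" "N \<subseteq> map_preimage h W'"
    "\<forall>x\<in>N. \<forall>y\<in>N. D W x y = D W' (the (h x)) (the (h y))"
    using D_invariant[OF h z(2) m(2) z(1) m'(2) z(3)] by blast
  have "N \<subseteq> ?A"
  proof
    fix x assume x: "x \<in> N"
    obtain w where "w \<in> W'" "h x = Some w"
      using subsetD[OF N(4) x] unfolding in_map_preimage_iff by blast
    then show "x \<in> ?A" using N(3) x m m' by (auto intro: ranI)
  qed
  then have "openin (subtopology mtopology ?A) N"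
    using openin_subtopology_Int[OF N(1), of ?A] by (simp add: inf.absorb1)
  then show "\<exists>V. openin (subtopology mtopology ?A) V \<and> z \<in> V \<and>
      (\<forall>x\<in>V. \<forall>y\<in>V. mdist m x y = mdist m' (the (h x)) (the (h y)))"
    using N(2,5) m m' by auto
qed

end

section \<open>The local metric\<close>

lemma locally_equal_cover_compatible:
  assumes "locally_equal_cover S F"
  shows "compatible_topologies F"
  unfolding compatible_topologies_def
proof (intro ballI conjI allI impI)
  fix m m' assume m: "m \<in> F" "m' \<in> F"
  let ?X = "mspace m \<inter> mspace m'"
  show X: "openin (mtopology_of m) ?X"
    using assms m unfolding locally_equal_cover_def by blast
  have X': "openin (mtopology_of m') ?X"
    using assms m unfolding locally_equal_cover_def by blast
  fix V assume V: "V \<subseteq> ?X" "openin (mtopology_of m) V"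
  show "openin (mtopology_of m') V"
  proof (cases "?X = {}")
    case True
    then show ?thesis using V by simp
  next
    case False
    then have "mtopology_of (submetric m ?X) = mtopology_of (submetric m' ?X)"
      using assms m unfolding locally_equal_cover_def metrics_locally_equal_def by blast
    then have "subtopology (mtopology_of m) ?X = subtopology (mtopology_of m') ?X"
      by (simp only: mtopology_of_submetric)
    then show ?thesis
      using V openin_open_subtopology[OF X, of V] openin_open_subtopology[OF X', of V] by simp
  qed
qed

lemma open_balls_base_equivalent:
  assumes compat: "compatible_topologies (F \<union> G)"
    and F: "(\<Union>m\<in>F. mspace m) = topspace Z" and G: "(\<Union>m\<in>G. mspace m) = topspace Z"
    and F_iff: "\<And>m V. m \<in> F \<Longrightarrow> openin (mtopology_of m) V \<longleftrightarrow> openin Z V \<and> V \<subseteq> mspace m"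
  shows "openin Z = arbitrary union_of (\<lambda>B. B \<in> open_balls G)"
proof -
  have swap: "openin (mtopology_of m') V" if "m \<in> F \<union> G" "m' \<in> F \<union> G" "V \<subseteq> mspace m" "V \<subseteq> mspace m'" "openin (mtopology_of m) V" for m m' V
    using compat that unfolding compatible_topologies_def by (metis le_inf_iff)
  have inter: "openin (mtopology_of m) (mspace m \<inter> mspace m')" if "m \<in> F \<union> G" "m' \<in> F \<union> G" for m m'
    using compat that unfolding compatible_topologies_def by blast
  have G_open: "openin (mtopology_of g) V \<longleftrightarrow> openin Z V \<and> V \<subseteq> mspace g" if g: "g \<in> G" for g V
  proof
    assume V: "openin (mtopology_of g) V"
    then have Vg: "V \<subseteq> mspace g" using openin_subset by fastforce
    have "\<exists>T. openin Z T \<and> x \<in> T \<and> T \<subseteq> V" if x: "x \<in> V" for x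
    proof -
      obtain m where m: "m \<in> F" "x \<in> mspace m" using F G g Vg x by blast
      have "openin (mtopology_of g) (V \<inter> (mspace g \<inter> mspace m))"
        using openin_Int[OF V inter] g m(1) by blast
      then have "openin (mtopology_of m) (V \<inter> (mspace g \<inter> mspace m))"
        using swap[of g m "V \<inter> (mspace g \<inter> mspace m)"] g m(1) by blast
      then show ?thesis using F_iff[OF m(1)] m(2) Vg x by blast
    qed
    then have "openin Z V" using openin_subopen[of Z V] by simp
    then show "openin Z V \<and> V \<subseteq> mspace g" using Vg by simp
  next
    assume V: "openin Z V \<and> V \<subseteq> mspace g"
    have "\<exists>T. openin (mtopology_of g) T \<and> x \<in> T \<and> T \<subseteq> V" if x: "x \<in> V" for x
    proof -
      obtain m where m: "m \<in> F" "x \<in> mspace m" using F G g V x by blast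
      have "openin Z (mspace m)"
        using F_iff[OF m(1), of "mspace m"] openin_topspace[of "mtopology_of m"] by simp
      then have "openin Z (V \<inter> mspace m)" using V by blast
      then have "openin (mtopology_of m) (V \<inter> mspace m)"
        using F_iff[OF m(1)] by blast
      then have "openin (mtopology_of g) (V \<inter> mspace m)"
        using swap[of m g "V \<inter> mspace m"] g m(1) V by blast
      then show ?thesis using m(2) x by blast
    qed
    then show "openin (mtopology_of g) V" using openin_subopen[of "mtopology_of g" V] by simp
  qed
  show ?thesis
  proof
    fix V
    have "openin Z V \<longleftrightarrow> (\<forall>x\<in>V. \<exists>B. B \<in> open_balls G \<and> x \<in> B \<and> B \<subseteq> V)"
    proof
      assume V: "openin Z V"
      show "\<forall>x\<in>V. \<exists>B. B \<in> open_balls G \<and> x \<in> B \<and> B \<subseteq> V"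
      proof
        fix x assume x: "x \<in> V"
        then have "x \<in> topspace Z" using openin_subset[OF V] by blast
        then obtain g where g: "g \<in> G" "x \<in> mspace g" using G by blast
        have "openin Z (mspace g)"
          using G_open[OF g(1), of "mspace g"] openin_topspace[of "mtopology_of g"] by simp
        then have "openin (mtopology_of g) (V \<inter> mspace g)"
          using G_open[OF g(1)] V by blast
        then show "\<exists>B. B \<in> open_balls G \<and> x \<in> B \<and> B \<subseteq> V"
          using openin_mtopology_of_ball[OF g(1), of "V \<inter> mspace g" x] x g(2) by blast
      qed
    next
      assume B: "\<forall>x\<in>V. \<exists>B. B \<in> open_balls G \<and> x \<in> B \<and> B \<subseteq> V"
      have "openin Z B" if "B \<in> open_balls G" for B
        using open_balls_openin[OF that] G_open by blast
      then show "openin Z V" using B openin_subopen[of Z V] by meson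
    qed
    then show "openin Z V = (arbitrary union_of (\<lambda>B. B \<in> open_balls G)) V"
      by (simp add: arbitrary_union_of_alt)
  qed
qed

lemma (in germ_extension) pseudogroup_of_local_isometries_exists:
  "\<exists>Q. local_metric M Q \<and> induces_topology Q mtopology \<and>
       pseudogroup_of_local_isometries mtopology Q H"
proof -
  let ?P = "locally_equal_cover M"
  define Q where "Q = union_equivalence ?P `` {invariant_metrics}"
  note cover = locally_equal_cover_invariant_metrics
  have "local_metric M Q"
    unfolding local_metric_def Q_def using cover by (intro quotientI) simp
  moreover have "induces_topology Q mtopology"
    unfolding induces_topology_def
  proof
    fix G assume "G \<in> Q"
    then have G: "?P G" "?P (invariant_metrics \<union> G)"
      by (auto simp: Q_def union_equivalence_def)
    show "openin mtopology = arbitrary union_of (\<lambda>B. B \<in> open_balls G)"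
    proof (rule open_balls_base_equivalent)
      show "compatible_topologies (invariant_metrics \<union> G)"
        using locally_equal_cover_compatible G(2) .
      show "(\<Union>m\<in>invariant_metrics. mspace m) = topspace mtopology"
        "(\<Union>m\<in>G. mspace m) = topspace mtopology"
        using cover G(1) unfolding locally_equal_cover_def topspace_mtopology by blast+
      show "openin (mtopology_of m) V \<longleftrightarrow> openin mtopology V \<and> V \<subseteq> mspace m"
        if "m \<in> invariant_metrics" for m V
        using that openin_D_iff mspace_D unfolding invariant_metrics_def by auto
    qed
  qed
  moreover have "invariant_metrics \<in> Q"
    using cover by (simp add: Q_def union_equivalence_def)
  then have "pseudogroup_of_local_isometries mtopology Q H"
    unfolding pseudogroup_of_local_isometries_def
    using H local_isometry_invariant_metrics by blast
  ultimately show ?thesis by blast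
qed

theorem theorem15p2:
  fixes Z :: "'a topology" and H :: "('a \<rightharpoonup> 'a) set"
  assumes "locally_compact_space Z"
    and "completely_metrizable_space Z" and "second_countable Z"
    and "pseudogroup Z H"
    and "compactly_generated Z H"
    and "quasi_effective Z H"
    and "strongly_equicontinuous Z H"
  shows "\<exists>D. local_metric (topspace Z) D \<and> induces_topology D Z \<and>
             pseudogroup_of_local_isometries Z D H"
proof -
  note H = \<open>pseudogroup Z H\<close>
  obtain M and d0 :: "'a \<Rightarrow> 'a \<Rightarrow> real" where M0: "Metric_space M d0" and Z0: "Z = Metric_space.mtopology M d0"
    using completely_metrizable_imp_metrizable_space[OF assms(2)] unfolding metrizable_space_def by blast
  define d where "d = Metric_space.capped_dist d0 1"
  interpret Metric_space M d
    unfolding d_def by (rule Metric_space.capped_dist[OF M0])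
  have Z: "Z = mtopology"
    unfolding Z0 d_def by (rule Metric_space.mtopology_capped_metric[OF M0, symmetric])
  have d_le_1: "d x y \<le> 1" for x y
    by (simp add: d_def Metric_space.capped_dist_def[OF M0])
  obtain U E where U: "openin Z U" "compactin Z (Z closure_of U)"
    and orbits: "\<forall>x\<in>topspace Z. orbit_of H x \<inter> U \<noteq> {}"
    and E: "finite E" "symmetric_maps E" "generates (subtopology Z U) E (pseudogroup_restriction H U)"
    and ext: "\<forall>g\<in>E. \<exists>g'\<in>H. Z closure_of dom g \<subseteq> dom g' \<and> g = g' |` dom g"
    using \<open>compactly_generated Z H\<close> unfolding compactly_generated_def by (elim exE conjE) (rule that)
  obtain S1 where S1: "generates Z S1 H" "symmetric_maps S1" "composition_closed S1" "identity_rigid Z S1"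
    using \<open>quasi_effective Z H\<close> unfolding quasi_effective_def identity_rigid_def[symmetric]
    by (elim exE conjE) (rule that)
  obtain Q F S2 where Q: "quasi_local_metric (topspace Z) Q" "induces_topology Q Z" "F \<in> Q"
    and S2: "generates Z S2 H" "symmetric_maps S2" "composition_closed S2"
    and equi: "\<forall>\<epsilon>::real. \<epsilon> > 0 \<longrightarrow> (\<exists>\<delta>::real. \<delta> > 0 \<and>
              (\<forall>h\<in>S2. \<forall>m\<in>F. \<forall>m'\<in>F.
                 \<forall>x \<in> mspace m \<inter> map_preimage h (mspace m' \<inter> ran h).
                 \<forall>y \<in> mspace m \<inter> map_preimage h (mspace m' \<inter> ran h).
                   mdist m x y < \<delta> \<longrightarrow> mdist m' (the (h x)) (the (h y)) < \<epsilon>))"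
    using \<open>strongly_equicontinuous Z H\<close> unfolding strongly_equicontinuous_def
    by (elim exE conjE bexE) (rule that)
  have F: "quasi_locally_equal_cover M F" "openin mtopology = arbitrary union_of (\<lambda>B. B \<in> open_balls F)"
  proof -
    show "quasi_locally_equal_cover M F"
      using Q(1,3) unfolding quasi_local_metric_def
      by (auto simp: quotient_def union_equivalence_def Z)
    show "openin mtopology = arbitrary union_of (\<lambda>B. B \<in> open_balls F)"
      using Q(2,3) unfolding induces_topology_def Z by blast
  qed
  have lt2: "local_transformation mtopology h" if "h \<in> S2" for h
    using pseudogroupD(1)[OF H, of h] S2(1) that unfolding generates_def Z by blast
  define S where "S = restrictions Z S1 \<inter> restrictions Z S2"
  have S: "germ_generating Z H S"
    unfolding S_def
    using germ_generating_Int germ_generating_restrictions[OF H S1(1-3)] germ_generating_restrictions[OF H S2] by blast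
  have rigid: "identity_rigid Z S"
    using identity_rigid_restrictions[OF S1(4)] unfolding S_def identity_rigid_def by blast
  define small where "small s \<eta> \<epsilon> \<delta> \<longleftrightarrow> (\<forall>x x' y y'. s x = Some x' \<longrightarrow> s y = Some y' \<longrightarrow>
      x \<in> mtopology closure_of U \<longrightarrow> x' \<in> mtopology closure_of U \<longrightarrow>
      d x y < \<delta> \<longrightarrow> d x' y' < \<eta> \<longrightarrow> d x' y' < \<epsilon>)" for s \<eta> \<epsilon> \<delta>
  have "\<exists>\<eta>>0. \<forall>\<epsilon>>0. \<exists>\<delta>>0. \<forall>s\<in>restrictions mtopology S2. small s \<eta> \<epsilon> \<delta>"
    unfolding small_def
    by (rule equicontinuous_on_compact[OF F U(2)[unfolded Z] lt2 equi[rule_format]])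
  moreover have "S \<subseteq> restrictions mtopology S2"
    unfolding S_def Z by blast
  ultimately have equi': "\<exists>\<eta>>0. \<forall>\<epsilon>>0. \<exists>\<delta>>0. \<forall>s\<in>S. small s \<eta> \<epsilon> \<delta>"
    by (meson subsetD)
  interpret germ_extension M d H S U
  proof unfold_locales
    show "pseudogroup mtopology H" "germ_generating mtopology H S" "identity_rigid mtopology S" "openin mtopology U"
      using H S rigid U(1) by (simp_all add: Z)
    show "orbit_of H x \<inter> U \<noteq> {}" if "x \<in> M" for x
      using orbits that by (simp add: Z)
    show "d x y \<le> 1" for x y by (rule d_le_1)
    show "\<exists>\<delta>>0. \<forall>x\<in>U. \<forall>g\<in>H. \<forall>y\<in>U. g x = Some y \<longrightarrow>
       (\<exists>s\<in>S. dom s = mball x \<delta> \<and> germ_eq mtopology s g x \<and> ran s \<subseteq> mball y \<epsilon>)" if "\<epsilon> > 0" for \<epsilon>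
      by (rule uniform_extension[OF H[unfolded Z] S[unfolded Z] U[unfolded Z] E(1,2) E(3)[unfolded Z] _ equi'[unfolded small_def] that])
        (use ext in \<open>simp add: Z\<close>)
  qed
  show ?thesis
    using pseudogroup_of_local_isometries_exists by (simp add: Z)
qed

end
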